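(* Assume that the flat torus $(T,\hat h)$ is the quotient of $\mathbb R^2$ (with the Euclidean metric) by the lattice $L$ of full rank. Let $A=2\pi(\alpha\,dx_1+\beta\,dx_2)$ with $(\alpha,\beta)\in\mathbb R^2$, viewed as a $1$-form on $T$, and let $P_A=(\alpha,\beta)$. Then a complete set of eigenfunctions of the magnetic Laplacian $\Delta_A$ with potential $A$ is indexed by $p^{\star}\in L^{\star}$ as follows: $$f_{p^{\star}}(x)=e^{2\pi i\langle p^{\star},x\rangle},$$ with associated eigenvalue $$\lambda(p^{\star})=4\pi^2|P_A-p^{\star}|^2 .$$ The spectrum is therefore $$\mathrm{spec}(T,\hat h,A)=\{4\pi^2|P_A-p^{\star}|^2:\ p^{\star}\in L^{\star}\}.$$
   Context: For a smooth real $1$-form $A$ on a compact Riemannian manifold $(M,h)$ without boundary, the magnetic Laplacian acts on $u\in C^\infty(M,\mathbb C)$ by $\Delta_Au=\Delta u+2i\langle A,du\rangle_h+(|A|_h^2-i\delta A)u$, where $\Delta\ge0$ is the Laplace-Beltrami operator ($\Delta u=-\sum_k\partial^2u/\partial x_k^2$ in Euclidean space) and $\delta$ the codifferential; $\mathrm{spec}(M,h,A)$ is its spectrum. The dual lattice is $L^{\star}=\{p^{\star}\in\mathbb R^2:\langle p^{\star},w\rangle\in\mathbb Z\text{ for all }w\in L\}$. Functions and forms on $T$ are identified with $L$-invariant ones on $\mathbb R^2$. "Complete" means complete system in $L^2(T,\mathbb C)$. *)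

theory Defs
  imports "HOL-Analysis.Analysis"
begin

section \<open>Lattices in the plane\<close>

definition lattice_basis :: "(real^2) set \<Rightarrow> real^2 \<Rightarrow> real^2 \<Rightarrow> bool" where
  "lattice_basis L v w \<longleftrightarrow> v \<noteq> w \<and> independent {v, w} \<and>
     L = {of_int m *\<^sub>R v + of_int n *\<^sub>R w | m n. True}"

definition full_rank_lattice :: "(real^2) set \<Rightarrow> bool" where
  "full_rank_lattice L \<longleftrightarrow> (\<exists>v w. lattice_basis L v w)"

definition dual_lattice :: "(real^2) set \<Rightarrow> (real^2) set" where
  "dual_lattice L = {p. \<forall>w\<in>L. p \<bullet> w \<in> \<int>}"

text \<open>A fundamental parallelogram of \<^term>\<open>L\<close>. It serves only to integrate \<^term>\<open>L\<close>-invariant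
  functions, and such integrals do not depend on the basis that is chosen.\<close>

definition fundamental_cell :: "(real^2) set \<Rightarrow> (real^2) set" where
  "fundamental_cell L =
     (let (v, w) = (SOME (v, w). lattice_basis L v w)
      in {s *\<^sub>R v + t *\<^sub>R w | s t. 0 \<le> s \<and> s < 1 \<and> 0 \<le> t \<and> t < 1})"

section \<open>Functions on the flat torus\<close>

text \<open>Functions on the torus are represented by \<^term>\<open>L\<close>-invariant functions on the plane.\<close>

definition lattice_invariant :: "(real^2) set \<Rightarrow> (real^2 \<Rightarrow> 'a) \<Rightarrow> bool" where
  "lattice_invariant L u \<longleftrightarrow> (\<forall>x. \<forall>w\<in>L. u (x + w) = u x)"

fun cont_diff :: "nat \<Rightarrow> (real^2 \<Rightarrow> complex) \<Rightarrow> bool" where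
  "cont_diff 0 u \<longleftrightarrow> continuous_on UNIV u"
| "cont_diff (Suc k) u \<longleftrightarrow>
     (\<forall>x. u differentiable (at x)) \<and> (\<forall>v. cont_diff k (\<lambda>x. frechet_derivative u (at x) v))"

definition smooth_torus :: "(real^2) set \<Rightarrow> (real^2 \<Rightarrow> complex) set" where
  "smooth_torus L = {u. lattice_invariant L u \<and> (\<forall>k. cont_diff k u)}"

text \<open>Elements of \<open>L\<^sup>2\<close> are represented by functions; two of them are the same vector if their
  distance in \<open>l2_norm\<close> is zero.\<close>

definition L2_torus :: "(real^2) set \<Rightarrow> (real^2 \<Rightarrow> complex) set" where
  "L2_torus L = {u. lattice_invariant L u \<and> u \<in> borel_measurable borel \<and>
     set_integrable lborel (fundamental_cell L) (\<lambda>x. (cmod (u x))\<^sup>2)}"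

definition l2_norm :: "(real^2) set \<Rightarrow> (real^2 \<Rightarrow> complex) \<Rightarrow> real" where
  "l2_norm L u = sqrt (LINT x:fundamental_cell L|lborel. (cmod (u x))\<^sup>2)"

text \<open>Complete system: the finite linear combinations are dense in \<open>L\<^sup>2\<close>.\<close>

definition complete_system ::
    "(real^2) set \<Rightarrow> 'i set \<Rightarrow> ('i \<Rightarrow> real^2 \<Rightarrow> complex) \<Rightarrow> bool" where
  "complete_system L I f \<longleftrightarrow> (\<forall>i\<in>I. f i \<in> L2_torus L) \<and>
     (\<forall>g\<in>L2_torus L. \<forall>\<epsilon>>0. \<exists>S c. finite S \<and> S \<subseteq> I \<and>
        l2_norm L (\<lambda>x. g x - (\<Sum>i\<in>S. c i * f i x)) < \<epsilon>)"

section \<open>The magnetic Laplacian\<close>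

text \<open>The 1-form \<open>A\<^sub>1 dx\<^sub>1 + A\<^sub>2 dx\<^sub>2\<close> is represented by its coefficient field
  \<open>A :: real^2 \<Rightarrow> real^2\<close>. The metric is Euclidean, so that \<open>\<langle>A, du\<rangle> = A\<^sub>1 \<partial>\<^sub>1u + A\<^sub>2 \<partial>\<^sub>2u\<close> and
  \<open>\<delta>A = - (\<partial>\<^sub>1A\<^sub>1 + \<partial>\<^sub>2A\<^sub>2)\<close>.\<close>

definition partial_deriv :: "2 \<Rightarrow> (real^2 \<Rightarrow> 'b::real_normed_vector) \<Rightarrow> real^2 \<Rightarrow> 'b" where
  "partial_deriv k u x = frechet_derivative u (at x) (axis k 1)"

definition laplacian :: "(real^2 \<Rightarrow> complex) \<Rightarrow> real^2 \<Rightarrow> complex" where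
  "laplacian u x = - (\<Sum>k\<in>UNIV. partial_deriv k (partial_deriv k u) x)"

definition codifferential :: "(real^2 \<Rightarrow> real^2) \<Rightarrow> real^2 \<Rightarrow> real" where
  "codifferential A x = - (\<Sum>k\<in>UNIV. partial_deriv k (\<lambda>y. A y $ k) x)"

definition magnetic_laplacian ::
    "(real^2 \<Rightarrow> real^2) \<Rightarrow> (real^2 \<Rightarrow> complex) \<Rightarrow> real^2 \<Rightarrow> complex" where
  "magnetic_laplacian A u x =
     laplacian u x
     + 2 * \<i> * (\<Sum>k\<in>UNIV. of_real (A x $ k) * partial_deriv k u x)
     + (of_real ((norm (A x))\<^sup>2) - \<i> * of_real (codifferential A x)) * u x"

definition magnetic_eigenfunction ::
    "(real^2) set \<Rightarrow> (real^2 \<Rightarrow> real^2) \<Rightarrow> complex \<Rightarrow> (real^2 \<Rightarrow> complex) \<Rightarrow> bool" where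
  "magnetic_eigenfunction L A z u \<longleftrightarrow>
     u \<in> smooth_torus L \<and> u \<noteq> (\<lambda>x. 0) \<and> (\<forall>x. magnetic_laplacian A u x = z * u x)"

section \<open>Spectrum\<close>

text \<open>The graph of the closure in \<open>L\<^sup>2\<close> of the magnetic Laplacian with domain the smooth functions
  on the torus.\<close>

definition magnetic_closure ::
    "(real^2) set \<Rightarrow> (real^2 \<Rightarrow> real^2) \<Rightarrow> ((real^2 \<Rightarrow> complex) \<times> (real^2 \<Rightarrow> complex)) set" where
  "magnetic_closure L A = {(u, h). u \<in> L2_torus L \<and> h \<in> L2_torus L \<and>
     (\<exists>\<phi>. (\<forall>n. \<phi> n \<in> smooth_torus L) \<and>
        (\<lambda>n. l2_norm L (\<lambda>x. \<phi> n x - u x)) \<longlonglongrightarrow> 0 \<and>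
        (\<lambda>n. l2_norm L (\<lambda>x. magnetic_laplacian A (\<phi> n) x - h x)) \<longlonglongrightarrow> 0)}"

text \<open>A number \<^term>\<open>z\<close> is in the resolvent set if the closure minus \<^term>\<open>z\<close> is a bijection from its domain
  onto \<open>L\<^sup>2\<close> with bounded inverse. The second conjunct contains both injectivity (modulo null
  functions) and the boundedness of the inverse.\<close>

definition magnetic_resolvent_set :: "(real^2) set \<Rightarrow> (real^2 \<Rightarrow> real^2) \<Rightarrow> complex set" where
  "magnetic_resolvent_set L A = {z.
     (\<forall>g\<in>L2_torus L. \<exists>u h. (u, h) \<in> magnetic_closure L A \<and>
        l2_norm L (\<lambda>x. h x - z * u x - g x) = 0) \<and>
     (\<exists>C. \<forall>(u, h)\<in>magnetic_closure L A. l2_norm L u \<le> C * l2_norm L (\<lambda>x. h x - z * u x))}"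

definition magnetic_spectrum :: "(real^2) set \<Rightarrow> (real^2 \<Rightarrow> real^2) \<Rightarrow> complex set" where
  "magnetic_spectrum L A = - magnetic_resolvent_set L A"

end

theory Submission
  imports Defs "HOL-Complex_Analysis.Cauchy_Integral_Theorem"
begin

text \<open>The characters \<open>e\<^sub>p(x) = exp (2\<pi>i\<langle>p, x\<rangle>)\<close> satisfy \<open>\<partial>\<^sub>k e\<^sub>p = 2\<pi>i p\<^sub>k e\<^sub>p\<close>, which gives the eigenvalues
  \<open>\<lambda>\<^sub>p = 4\<pi>\<^sup>2|P - p|\<^sup>2\<close>. A dual basis embeds the torus into \<open>\<complex> \<times> \<complex>\<close> by two characters; polynomials are
  dense in \<open>L\<^sup>2\<close> of the image measure (inner and outer regularity, Urysohn, Stone-Weierstrass), and they pull back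
  to trigonometric polynomials. Translation invariance of the integral over a cell shows that derivatives of
  periodic functions have integral zero, hence the characters are orthogonal and
  \<open>\<integral> (\<Delta>\<^sub>A u) e\<^bsub>-p\<^esub> = \<lambda>\<^sub>p \<integral> u e\<^bsub>-p\<^esub>\<close>. If \<open>z\<close> is no eigenvalue, then \<open>|\<lambda>\<^sub>p - z| \<ge> d > 0\<close> because the dual lattice is
  discrete, so \<open>d \<parallel>u\<parallel> \<le> \<parallel>\<Delta>\<^sub>A u - z u\<parallel>\<close> for smooth \<open>u\<close> by duality with trigonometric polynomials. This
  bounds the inverse, and it makes the preimages of trigonometric approximations of \<open>g\<close> a Cauchy sequence,
  whose limit solves the resolvent equation.\<close>

section \<open>Square-integrable functions on a measure space\<close>

text \<open>Vectors of \<open>L2_torus\<close> are genuine functions, invariant at every point, and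
  not classes. A limit in L^2 must therefore be produced as a function that is periodic everywhere.
  For this reason completeness yields the pointwise \<open>lim\<close> of a subsequence, which
  inherits all periods, also at points where the subsequence diverges. The general theory concerns a
  seminorm over a measure space, because two measures occur: Lebesgue measure cut down to one cell,
  and its image on a product of two circles. On the image periodicity takes care of itself, and
  density of polynomials over a compact subset of a Euclidean space applies. The spectrum is that of
  a closure; all facts about it are transported from smooth functions by one a priori inequality.
  Its constant \<open>d\<close> bounds the inverse and controls the Cauchy sequence that solves the
  resolvent equation. Fourier coefficients are always paired with finite sums, so Parseval for
  finite sums carries the whole estimate.\<close>

definition L2_space :: "'a measure \<Rightarrow> ('a \<Rightarrow> complex) set" where
  "L2_space M = {u. u \<in> borel_measurable M \<and> integrable M (\<lambda>x. (cmod (u x))\<^sup>2)}"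

definition L2_seminorm :: "'a measure \<Rightarrow> ('a \<Rightarrow> complex) \<Rightarrow> real" where
  "L2_seminorm M u = sqrt (LINT x|M. (cmod (u x))\<^sup>2)"

lemma L2_spaceD:
  assumes "u \<in> L2_space M"
  shows "u \<in> borel_measurable M" "integrable M (\<lambda>x. (cmod (u x))\<^sup>2)"
  using assms by (auto simp: L2_space_def)

lemma L2_seminorm_nonneg [simp]: "L2_seminorm M u \<ge> 0"
  by (simp add: L2_seminorm_def)

lemma L2_seminorm_power2: "(L2_seminorm M u)\<^sup>2 = (LINT x|M. (cmod (u x))\<^sup>2)"
  by (simp add: L2_seminorm_def)

lemma L2_seminorm_minus_commute: "L2_seminorm M (\<lambda>x. u x - v x) = L2_seminorm M (\<lambda>x. v x - u x)"
  by (simp add: L2_seminorm_def norm_minus_commute)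

lemma L2_seminorm_mult: "L2_seminorm M (\<lambda>x. c * u x) = cmod c * L2_seminorm M u"
  by (simp add: L2_seminorm_def norm_mult power_mult_distrib real_sqrt_mult)

lemma L2_space_mult: "u \<in> L2_space M \<Longrightarrow> (\<lambda>x. c * u x) \<in> L2_space M"
  by (auto simp: L2_space_def norm_mult power_mult_distrib)

lemma L2_space_cnj: "u \<in> L2_space M \<Longrightarrow> (\<lambda>x. cnj (u x)) \<in> L2_space M"
  by (auto simp: L2_space_def intro: borel_measurable_continuous_onI[THEN measurable_compose_rev] continuous_intros)

lemma L2_space_mult_integrable:
  assumes "u \<in> L2_space M" "v \<in> L2_space M"
  shows "integrable M (\<lambda>x. u x * v x)"
proof (rule Bochner_Integration.integrable_bound)
  show "integrable M (\<lambda>x. (cmod (u x))\<^sup>2 + (cmod (v x))\<^sup>2)"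
    using assms by (auto simp: L2_space_def)
  show "(\<lambda>x. u x * v x) \<in> borel_measurable M"
    using assms by (intro borel_measurable_times L2_spaceD)
  have "a * b \<le> a\<^sup>2 + b\<^sup>2" if "0 \<le> a" "0 \<le> b" for a b :: real
    using sum_squares_bound[of a b] mult_nonneg_nonneg[OF that] by simp
  then show "AE x in M. norm (u x * v x) \<le> norm ((cmod (u x))\<^sup>2 + (cmod (v x))\<^sup>2)"
    by (simp add: norm_mult)
qed

lemma L2_space_add:
  assumes "u \<in> L2_space M" "v \<in> L2_space M"
  shows "(\<lambda>x. u x + v x) \<in> L2_space M"
proof -
  have m: "u \<in> borel_measurable M" "v \<in> borel_measurable M" using assms by (auto simp: L2_space_def)
  have "integrable M (\<lambda>x. (cmod (u x + v x))\<^sup>2)"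
  proof (rule Bochner_Integration.integrable_bound)
    show "integrable M (\<lambda>x. 2 * (cmod (u x))\<^sup>2 + 2 * (cmod (v x))\<^sup>2)"
      using assms by (auto simp: L2_space_def)
    show "(\<lambda>x. (cmod (u x + v x))\<^sup>2) \<in> borel_measurable M"
      using m by measurable
    have "(cmod (a + b))\<^sup>2 \<le> 2 * (cmod a)\<^sup>2 + 2 * (cmod b)\<^sup>2" for a b
    proof -
      have "(cmod (a + b))\<^sup>2 \<le> (cmod a + cmod b)\<^sup>2"
        by (intro power_mono norm_triangle_ineq) auto
      then show ?thesis using sum_squares_bound[of "cmod a" "cmod b"] by (simp add: power2_sum)
    qed
    then show "AE x in M. norm ((cmod (u x + v x))\<^sup>2) \<le> norm (2 * (cmod (u x))\<^sup>2 + 2 * (cmod (v x))\<^sup>2)"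
      by simp
  qed
  then show ?thesis using m by (auto simp: L2_space_def)
qed

lemma L2_space_diff:
  assumes "u \<in> L2_space M" "v \<in> L2_space M"
  shows "(\<lambda>x. u x - v x) \<in> L2_space M"
  using L2_space_add[OF assms(1) L2_space_mult[OF assms(2), of "-1"]] by simp

section \<open>Cauchy-Schwarz and the triangle inequality\<close>

lemma ennreal_L2_seminorm_power2:
  assumes "u \<in> L2_space M"
  shows "(\<integral>\<^sup>+x. ennreal ((cmod (u x))\<^sup>2) \<partial>M) = ennreal ((L2_seminorm M u)\<^sup>2)"
  using assms unfolding L2_seminorm_power2
  by (subst nn_integral_eq_integral[symmetric]) (auto simp: L2_space_def)

text \<open>Transferred from the inequality for nonnegative extended integrals. The moduli stand
  inside the integral because the triangle inequality and the comparison with L^1 use this stronger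
  form.\<close>

lemma L2_Cauchy_Schwarz_norm:
  assumes u: "u \<in> L2_space M" and v: "v \<in> L2_space M"
  shows "(LINT x|M. cmod (u x) * cmod (v x)) \<le> L2_seminorm M u * L2_seminorm M v"
proof -
  have m [measurable]: "u \<in> borel_measurable M" "v \<in> borel_measurable M" using assms by (auto simp: L2_space_def)
  define I where "I = (LINT x|M. cmod (u x) * cmod (v x))"
  have I: "I \<ge> 0" by (simp add: I_def)
  have "integrable M (\<lambda>x. cmod (u x) * cmod (v x))"
    using integrable_norm[OF L2_space_mult_integrable[OF u v]] by (simp add: norm_mult)
  then have "(\<integral>\<^sup>+x. ennreal (cmod (u x)) * ennreal (cmod (v x)) \<partial>M) = ennreal I"
    unfolding I_def by (subst nn_integral_eq_integral[symmetric]) (auto simp: ennreal_mult)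
  moreover have "(\<integral>\<^sup>+x. ennreal (cmod (u x)) * ennreal (cmod (v x)) \<partial>M)\<^sup>2
      \<le> (\<integral>\<^sup>+x. ennreal (cmod (u x)) ^ 2 \<partial>M) * (\<integral>\<^sup>+x. ennreal (cmod (v x)) ^ 2 \<partial>M)"
    by (rule Cauchy_Schwarz_nn_integral) measurable
  ultimately have "ennreal (I\<^sup>2) \<le> ennreal ((L2_seminorm M u * L2_seminorm M v)\<^sup>2)"
    using I by (simp add: ennreal_L2_seminorm_power2 u v ennreal_power flip: ennreal_mult power_mult_distrib)
  then have "I\<^sup>2 \<le> (L2_seminorm M u * L2_seminorm M v)\<^sup>2" by simp
  then show ?thesis unfolding I_def by (rule power2_le_imp_le) simp
qed

lemma L2_Cauchy_Schwarz:
  assumes u: "u \<in> L2_space M" and v: "v \<in> L2_space M"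
  shows "cmod (LINT x|M. u x * v x) \<le> L2_seminorm M u * L2_seminorm M v"
  using integral_norm_bound[of M "\<lambda>x. u x * v x"] L2_Cauchy_Schwarz_norm[OF assms]
  by (simp add: norm_mult)

lemma L2_seminorm_triangle:
  assumes u: "u \<in> L2_space M" and v: "v \<in> L2_space M"
  shows "L2_seminorm M (\<lambda>x. u x + v x) \<le> L2_seminorm M u + L2_seminorm M v"
proof -
  have i: "integrable M (\<lambda>x. cmod (u x) * cmod (v x))"
    using integrable_norm[OF L2_space_mult_integrable[OF u v]] by (simp add: norm_mult)
  have "(L2_seminorm M (\<lambda>x. u x + v x))\<^sup>2
      \<le> (LINT x|M. (cmod (u x))\<^sup>2 + (cmod (v x))\<^sup>2 + 2 * (cmod (u x) * cmod (v x)))"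
    unfolding L2_seminorm_power2
  proof (rule integral_mono)
    show "(cmod (u x + v x))\<^sup>2 \<le> (cmod (u x))\<^sup>2 + (cmod (v x))\<^sup>2 + 2 * (cmod (u x) * cmod (v x))" for x
      using power_mono[OF norm_triangle_ineq[of "u x" "v x"], of 2] by (simp add: power2_sum)
  qed (use u v i L2_space_add[OF u v] in \<open>auto simp: L2_space_def\<close>)
  also have "\<dots> = (L2_seminorm M u)\<^sup>2 + (L2_seminorm M v)\<^sup>2 + 2 * (LINT x|M. cmod (u x) * cmod (v x))"
    using u v i unfolding L2_seminorm_power2
    by (simp add: L2_space_def)
  also have "\<dots> \<le> (L2_seminorm M u + L2_seminorm M v)\<^sup>2"
    using L2_Cauchy_Schwarz_norm[OF u v] by (simp add: power2_sum)
  finally show ?thesis by (rule power2_le_imp_le) simp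
qed

lemma L2_seminorm_triangle_diff:
  assumes "u \<in> L2_space M" "v \<in> L2_space M" "w \<in> L2_space M"
  shows "L2_seminorm M (\<lambda>x. u x - w x)
    \<le> L2_seminorm M (\<lambda>x. u x - v x) + L2_seminorm M (\<lambda>x. v x - w x)"
  using L2_seminorm_triangle[OF L2_space_diff[OF assms(1,2)] L2_space_diff[OF assms(2,3)]] by simp

lemma L2_seminorm_le_add_diff:
  assumes "u \<in> L2_space M" "v \<in> L2_space M"
  shows "L2_seminorm M u \<le> L2_seminorm M v + L2_seminorm M (\<lambda>x. u x - v x)"
  using L2_seminorm_triangle[OF assms(2) L2_space_diff[OF assms]] by simp

lemma L2_seminorm_tendsto:
  assumes "\<And>n. u n \<in> L2_space M" "v \<in> L2_space M" "(\<lambda>n. L2_seminorm M (\<lambda>x. u n x - v x)) \<longlonglongrightarrow> 0"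
  shows "(\<lambda>n. L2_seminorm M (u n)) \<longlonglongrightarrow> L2_seminorm M v"
proof -
  have "\<bar>L2_seminorm M (u n) - L2_seminorm M v\<bar> \<le> L2_seminorm M (\<lambda>x. u n x - v x)" for n
    using L2_seminorm_le_add_diff[OF assms(1,2), of n] L2_seminorm_le_add_diff[OF assms(2,1), of n]
    by (simp add: L2_seminorm_minus_commute[of M v])
  then have "(\<lambda>n. L2_seminorm M (u n) - L2_seminorm M v) \<longlonglongrightarrow> 0"
    by (intro Lim_null_comparison[OF always_eventually assms(3)]) auto
  then show ?thesis by (simp add: LIM_zero_iff)
qed

section \<open>Finite measures: bounded functions, comparison with L^1, completeness\<close>

context finite_measure
begin

lemma bounded_L2_space:
  assumes "u \<in> borel_measurable M" "AE x in M. cmod (u x) \<le> B"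
  shows "u \<in> L2_space M"
proof -
  have "integrable M (\<lambda>x. (cmod (u x))\<^sup>2)"
  proof (rule integrable_const_bound)
    show "AE x in M. norm ((cmod (u x))\<^sup>2) \<le> B\<^sup>2"
      using assms(2) by eventually_elim (simp add: power_mono)
  qed (use assms(1) in measurable)
  then show ?thesis using assms(1) by (auto simp: L2_space_def)
qed

lemma L2_seminorm_le_bound:
  assumes "u \<in> borel_measurable M" "AE x in M. cmod (u x) \<le> B" "B \<ge> 0"
  shows "L2_seminorm M u \<le> B * sqrt (measure M (space M))"
proof -
  have "(LINT x|M. (cmod (u x))\<^sup>2) \<le> (LINT x|M. B\<^sup>2)"
  proof (rule integral_mono_AE)
    show "AE x in M. (cmod (u x))\<^sup>2 \<le> B\<^sup>2"
      using assms(2) by eventually_elim (simp add: power_mono)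
  qed (use bounded_L2_space[OF assms(1,2)] in \<open>auto simp: L2_space_def\<close>)
  then have "L2_seminorm M u \<le> sqrt (B\<^sup>2 * measure M (space M))"
    by (simp add: L2_seminorm_def mult.commute)
  then show ?thesis using assms(3) by (simp add: real_sqrt_mult)
qed

lemma L2_imp_integrable:
  assumes "u \<in> L2_space M"
  shows "integrable M u"
proof -
  have "(\<lambda>x. 1) \<in> L2_space M" by (rule bounded_L2_space[of _ 1]) auto
  from L2_space_mult_integrable[OF assms this] show ?thesis by simp
qed

lemma L1_le_L2:
  assumes "u \<in> L2_space M"
  shows "(LINT x|M. cmod (u x)) \<le> L2_seminorm M u * sqrt (measure M (space M))"
proof -
  have 1: "(\<lambda>x. 1) \<in> L2_space M" by (rule bounded_L2_space[of _ 1]) auto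
  show ?thesis using L2_Cauchy_Schwarz_norm[OF assms 1] by (simp add: L2_seminorm_def)
qed

text \<open>Over a finite measure an L^2-Cauchy sequence is L^1-Cauchy, so some subsequence
  converges almost everywhere, and Fatou upgrades this to L^2 convergence of the whole sequence. The
  limit is named explicitly as a pointwise \<open>lim\<close> so that invariance can later be read
  off from it.\<close>

lemma L2_complete:
  assumes u: "\<And>n. u n \<in> L2_space M"
    and C: "\<And>e. e > 0 \<Longrightarrow> \<exists>N. \<forall>i\<ge>N. \<forall>j\<ge>N. L2_seminorm M (\<lambda>x. u i x - u j x) < e"
  obtains r :: "nat \<Rightarrow> nat" where "strict_mono r"
    "(\<lambda>x. lim (\<lambda>n. u (r n) x)) \<in> L2_space M"
    "(\<lambda>n. L2_seminorm M (\<lambda>x. u n x - lim (\<lambda>n. u (r n) x))) \<longlonglongrightarrow> 0"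
proof -
  have m [measurable]: "u n \<in> borel_measurable M" for n using u by (simp add: L2_spaceD)
  have "\<exists>N. \<forall>i\<ge>N. \<forall>j\<ge>N. LINT x|M. norm (u i x - u j x) < e" if "e > 0" for e
  proof -
    \<comment> \<open>The summand 1 keeps \<open>k\<close> positive when the measure is
      zero.\<close>
    define k where "k = sqrt (measure M (space M)) + 1"
    have k: "k > 0" by (simp add: k_def add_nonneg_pos)
    obtain N where N: "\<forall>i\<ge>N. \<forall>j\<ge>N. L2_seminorm M (\<lambda>x. u i x - u j x) < e / k"
      using C[of "e / k"] \<open>e > 0\<close> k by auto
    have "LINT x|M. norm (u i x - u j x) < e" if "i \<ge> N" "j \<ge> N" for i j
    proof -
      have "(LINT x|M. norm (u i x - u j x)) \<le> L2_seminorm M (\<lambda>x. u i x - u j x) * sqrt (measure M (space M))"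
        by (rule L1_le_L2[OF L2_space_diff[OF u u]])
      also have "\<dots> \<le> L2_seminorm M (\<lambda>x. u i x - u j x) * k"
        by (intro mult_left_mono) (auto simp: k_def)
      also have "\<dots> < e" using N that k by (simp add: pos_less_divide_eq)
      finally show ?thesis .
    qed
    then show ?thesis by blast
  qed
  then obtain r where r: "strict_mono r" "AE x in M. Cauchy (\<lambda>i. u (r i) x)"
    using cauchy_L1_AE_cauchy_subseq[of M u] L2_imp_integrable[OF u] by blast
  define w where "w x = lim (\<lambda>n. u (r n) x)" for x
  have w [measurable]: "w \<in> borel_measurable M" unfolding w_def by measurable
  have conv: "AE x in M. (\<lambda>i. u (r i) x) \<longlonglongrightarrow> w x"
    using r(2) by eventually_elim (simp add: w_def Cauchy_convergent_iff convergent_LIMSEQ_iff)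
  \<comment> \<open>Fatou with \<open>i\<close> fixed and \<open>r n\<close> running to infinity;
    the strict bound by \<open>e\<close> weakens to a non-strict one. It is applied twice: with 1 to
    place \<open>w\<close> in L^2, and with \<open>e / 2\<close> to obtain convergence.\<close>
  have bound: "(\<lambda>x. u i x - w x) \<in> L2_space M \<and> L2_seminorm M (\<lambda>x. u i x - w x) \<le> e"
    if e: "e > 0" and N: "\<forall>i\<ge>N. \<forall>j\<ge>N. L2_seminorm M (\<lambda>x. u i x - u j x) < e" and i: "i \<ge> N" for i e N
  proof -
    have "AE x in M. liminf (\<lambda>n. ennreal ((cmod (u i x - u (r n) x))\<^sup>2)) = ennreal ((cmod (u i x - w x))\<^sup>2)"
      using conv
    proof eventually_elim
      case (elim x)
      then have "(\<lambda>n. ennreal ((cmod (u i x - u (r n) x))\<^sup>2)) \<longlonglongrightarrow> ennreal ((cmod (u i x - w x))\<^sup>2)"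
        by (intro tendsto_intros)
      then show ?case by (rule lim_imp_Liminf[OF sequentially_bot])
    qed
    then have "(\<integral>\<^sup>+x. ennreal ((cmod (u i x - w x))\<^sup>2) \<partial>M)
        = (\<integral>\<^sup>+x. liminf (\<lambda>n. ennreal ((cmod (u i x - u (r n) x))\<^sup>2)) \<partial>M)"
      by (intro nn_integral_cong_AE) auto
    also have "\<dots> \<le> liminf (\<lambda>n. \<integral>\<^sup>+x. ennreal ((cmod (u i x - u (r n) x))\<^sup>2) \<partial>M)"
      by (rule nn_integral_liminf) measurable
    also have "\<dots> \<le> ennreal (e\<^sup>2)"
    proof (rule Liminf_le)
      have "\<forall>\<^sub>F n in sequentially. (\<integral>\<^sup>+x. ennreal ((cmod (u i x - u (r n) x))\<^sup>2) \<partial>M) \<le> ennreal (e\<^sup>2)"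
        using eventually_ge_at_top[of N]
      proof eventually_elim
        case (elim n)
        have d: "(\<lambda>x. u i x - u (r n) x) \<in> L2_space M" using u by (intro L2_space_diff)
        have "r n \<ge> N" using seq_suble[OF r(1), of n] elim by linarith
        then have "L2_seminorm M (\<lambda>x. u i x - u (r n) x) < e" using N i by blast
        then have "(L2_seminorm M (\<lambda>x. u i x - u (r n) x))\<^sup>2 \<le> e\<^sup>2" by (intro power_mono) auto
        then show ?case using ennreal_L2_seminorm_power2[OF d] by simp
      qed
      then show "\<forall>\<^sub>F n in sequentially. (\<integral>\<^sup>+x. ennreal ((cmod (u i x - u (r n) x))\<^sup>2) \<partial>M) \<le> ennreal (e\<^sup>2)" .
    qed simp
    finally have le: "(\<integral>\<^sup>+x. ennreal ((cmod (u i x - w x))\<^sup>2) \<partial>M) \<le> ennreal (e\<^sup>2)" .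
    then have "(\<integral>\<^sup>+x. ennreal ((cmod (u i x - w x))\<^sup>2) \<partial>M) < \<infinity>"
      by (simp add: order_le_less_trans)
    then have int: "integrable M (\<lambda>x. (cmod (u i x - w x))\<^sup>2)"
      unfolding integrable_iff_bounded by simp
    then have L: "(\<lambda>x. u i x - w x) \<in> L2_space M"
      unfolding L2_space_def by simp
    have "ennreal ((L2_seminorm M (\<lambda>x. u i x - w x))\<^sup>2) \<le> ennreal (e\<^sup>2)"
      using le ennreal_L2_seminorm_power2[OF L] by simp
    then have "(L2_seminorm M (\<lambda>x. u i x - w x))\<^sup>2 \<le> e\<^sup>2" by simp
    then have "L2_seminorm M (\<lambda>x. u i x - w x) \<le> e"
      by (rule power2_le_imp_le) (use e in simp)
    with L show ?thesis by blast
  qed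
  obtain N where N: "\<forall>i\<ge>N. \<forall>j\<ge>N. L2_seminorm M (\<lambda>x. u i x - u j x) < 1" using C[of 1] by auto
  have "(\<lambda>x. u N x - (u N x - w x)) \<in> L2_space M"
    using L2_space_diff[OF u[of N] conjunct1[OF bound[OF _ N, of N]]] by simp
  then have wL: "w \<in> L2_space M" by simp
  have lim: "(\<lambda>n. L2_seminorm M (\<lambda>x. u n x - w x)) \<longlonglongrightarrow> 0"
  proof (rule LIMSEQ_I)
    fix e :: real assume "e > 0"
    then obtain N where N: "\<forall>i\<ge>N. \<forall>j\<ge>N. L2_seminorm M (\<lambda>x. u i x - u j x) < e / 2"
      using C[of "e / 2"] by auto
    have "L2_seminorm M (\<lambda>x. u n x - w x) < e" if "n \<ge> N" for n
      using bound[OF _ N that] \<open>e > 0\<close> by simp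
    then show "\<exists>N. \<forall>n\<ge>N. norm (L2_seminorm M (\<lambda>x. u n x - w x) - 0) < e" by auto
  qed
  show ?thesis
    by (rule that[OF r(1)]) (use wL lim in \<open>simp_all add: w_def[abs_def]\<close>)
qed

end

text \<open>The approximable functions form a class closed under sums and L^2 limits. It contains
  the continuous functions, by uniform approximation on \<open>K\<close>, which carries the measure;
  then indicators of Borel sets, by regularity; then simple functions; and finally all of
  L^2.\<close>

lemma polynomial_functions_dense_L2:
  fixes M :: "'a::euclidean_space measure" and g :: "'a \<Rightarrow> complex"
  assumes fin: "finite_measure M" and sets [measurable_cong]: "sets M = sets borel"
    and K: "compact K" "AE x in M. x \<in> K" and g: "g \<in> L2_space M" and e: "e > 0"
  shows "\<exists>q. polynomial_function q \<and> q \<in> L2_space M \<and> L2_seminorm M (\<lambda>x. g x - q x) < e"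
proof -
  interpret finite_measure M by fact
  have sp: "space M = UNIV" using sets_eq_imp_space_eq[OF sets] by simp
  define V where "V = {g \<in> L2_space M. \<forall>e>0. \<exists>q. polynomial_function q \<and> q \<in> L2_space M \<and>
      L2_seminorm M (\<lambda>x. g x - q x) < e}"
  have V_lim: "g \<in> V" if "g \<in> L2_space M" and *: "\<And>e. e > 0 \<Longrightarrow> \<exists>h\<in>V. L2_seminorm M (\<lambda>x. g x - h x) < e" for g
    unfolding V_def
  proof (safe intro!: that(1))
    fix e :: real assume "e > 0"
    then obtain h where h: "h \<in> V" "L2_seminorm M (\<lambda>x. g x - h x) < e / 2" using *[of "e / 2"] by auto
    then obtain q where q: "polynomial_function q" "q \<in> L2_space M" "L2_seminorm M (\<lambda>x. h x - q x) < e / 2"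
      using \<open>e > 0\<close> unfolding V_def by (auto dest!: spec[of _ "e / 2"])
    moreover have "L2_seminorm M (\<lambda>x. g x - q x) < e"
      using L2_seminorm_triangle_diff[OF that(1), of h q] h q by (auto simp: V_def)
    ultimately show "\<exists>q. polynomial_function q \<and> q \<in> L2_space M \<and> L2_seminorm M (\<lambda>x. g x - q x) < e"
      by blast
  qed
  have V_add: "(\<lambda>x. g x + h x) \<in> V" if g: "g \<in> V" and h: "h \<in> V" for g h
    unfolding V_def
  proof safe
    show "(\<lambda>x. g x + h x) \<in> L2_space M" using g h by (auto simp: V_def intro: L2_space_add)
    fix e :: real assume "e > 0"
    then obtain q r where q: "polynomial_function q" "q \<in> L2_space M" "L2_seminorm M (\<lambda>x. g x - q x) < e / 2"
      and r: "polynomial_function r" "r \<in> L2_space M" "L2_seminorm M (\<lambda>x. h x - r x) < e / 2"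
      using g h unfolding V_def by (fastforce dest!: spec[of _ "e / 2"])
    have "L2_seminorm M (\<lambda>x. (g x - q x) + (h x - r x)) < e"
      using L2_seminorm_triangle[OF L2_space_diff[OF _ q(2)] L2_space_diff[OF _ r(2)], of g h] q r g h
      by (auto simp: V_def)
    then have "L2_seminorm M (\<lambda>x. g x + h x - (q x + r x)) < e"
      by (simp add: algebra_simps)
    then show "\<exists>q. polynomial_function q \<and> q \<in> L2_space M \<and> L2_seminorm M (\<lambda>x. g x + h x - q x) < e"
      using q r by (intro exI[of _ "\<lambda>x. q x + r x"]) (auto intro: L2_space_add)
  qed
  have V_cont: "g \<in> V" if g: "continuous_on UNIV g" for g
  proof -
    have L: "h \<in> L2_space M" if h: "continuous_on UNIV h" for h
    proof -
      have "bounded (h ` K)"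
        by (intro compact_imp_bounded compact_continuous_image K continuous_on_subset[OF h]) auto
      then obtain B where "\<And>x. x \<in> K \<Longrightarrow> cmod (h x) \<le> B" by (auto simp: bounded_iff)
      then have "AE x in M. cmod (h x) \<le> B" using K(2) by auto
      then show ?thesis
        by (rule bounded_L2_space[rotated])
          (use borel_measurable_continuous_onI[OF h] in \<open>simp add: measurable_cong_sets[OF sets refl]\<close>)
    qed
    show ?thesis unfolding V_def
    proof (safe intro!: L[OF g])
      fix e :: real assume e: "e > 0"
      define k where "k = sqrt (measure M (space M)) + 1"
      have k: "k > 0" by (simp add: k_def add_nonneg_pos)
      obtain q where q: "polynomial_function q" "\<forall>x\<in>K. cmod (g x - q x) < e / k"
        using Stone_Weierstrass_polynomial_function[OF K(1) continuous_on_subset[OF g], of "e / k"] e k by auto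
      have cq: "continuous_on UNIV q"
        using continuous_on_polymonial_function[OF q(1)] .
      have "L2_seminorm M (\<lambda>x. g x - q x) \<le> e / k * sqrt (measure M (space M))"
      proof (rule L2_seminorm_le_bound)
        show "AE x in M. cmod (g x - q x) \<le> e / k" using K(2) by eventually_elim (use q in force)
        show "(\<lambda>x. g x - q x) \<in> borel_measurable M"
          using L2_spaceD(1)[OF L2_space_diff[OF L[OF g] L[OF cq]]] .
      qed (use e k in simp)
      also have "\<dots> < e / k * k" using e k by (intro mult_strict_left_mono) (auto simp: k_def)
      also have "\<dots> = e" using k by simp
      finally show "\<exists>q. polynomial_function q \<and> q \<in> L2_space M \<and> L2_seminorm M (\<lambda>x. g x - q x) < e"
        using q(1) L[OF cq] by blast
    qed
  qed
  have V_ind: "(\<lambda>x. indicator B x *\<^sub>R c) \<in> V" if B: "B \<in> sets borel" for B and c :: complex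
  proof (rule V_lim)
    have [measurable]: "B \<in> sets M" using B sets by simp
    have m: "(\<lambda>x. indicator B x *\<^sub>R c) \<in> borel_measurable M" by measurable
    show "(\<lambda>x. indicator B x *\<^sub>R c) \<in> L2_space M"
      by (rule bounded_L2_space[OF m, of "cmod c"]) (auto simp: indicator_def)
    fix e :: real assume e: "e > 0"
    \<comment> \<open>Chosen so that an exceptional set of measure below \<open>2 * d\<close>
      contributes an error of at most e |c| / (|c| + 1), which is less than \<open>e\<close> also
      for c = 0.\<close>
    define d where "d = (e / (cmod c + 1))\<^sup>2 / 2"
    have "cmod c + 1 > 0" by (simp add: add_nonneg_pos)
    then have d: "d > 0" using e by (simp add: d_def)
    have fin: "emeasure M (space M) \<noteq> \<infinity>" by simp
    have "ennreal (measure M B) < ennreal (measure M B) + ennreal d"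
      using d by (simp add: ennreal_less_iff flip: ennreal_plus)
    then have "(INF U \<in> {U. B \<subseteq> U \<and> open U}. emeasure M U) < emeasure M B + d"
      unfolding outer_regular[OF sets fin B, symmetric] by (simp add: emeasure_eq_measure)
    then obtain U where U: "B \<subseteq> U" "open U" "emeasure M U < emeasure M B + d"
      by (auto simp: INF_less_iff)
    \<comment> \<open>The case split is due to \<open>ennreal\<close>, which truncates a negative
      \<open>measure M B - d\<close> to 0 and so would lose the strict inequality. In that case the
      empty set serves.\<close>
    have "\<exists>C. C \<subseteq> B \<and> compact C \<and> measure M B < measure M C + d"
    proof (cases "measure M B < d")
      case True
      then show ?thesis by (intro exI[of _ "{}"]) auto
    next
      case False
      then have "ennreal (measure M B - d) < ennreal (measure M B)"
        using d by (intro ennreal_lessI) auto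
      then have "ennreal (measure M B - d) < (SUP C \<in> {C. C \<subseteq> B \<and> compact C}. emeasure M C)"
        unfolding inner_regular[OF sets fin B, symmetric] by (simp add: emeasure_eq_measure)
      then obtain C where C: "C \<subseteq> B" "compact C" "ennreal (measure M B - d) < emeasure M C"
        by (auto simp: less_SUP_iff)
      then show ?thesis using False by (auto simp: emeasure_eq_measure ennreal_less_iff)
    qed
    then obtain C where C: "C \<subseteq> B" "compact C" "measure M B < measure M C + d" by blast
    have Cm [measurable]: "C \<in> sets M" using C(2) sets by (simp add: compact_imp_closed)
    have Um [measurable]: "U \<in> sets M" using U(2) sets by simp
    have "measure M U < measure M B + d"
      using U(3) d by (simp add: emeasure_eq_measure ennreal_less_iff flip: ennreal_plus)
    then have UC: "measure M (U - C) < 2 * d"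
      using C U by (subst finite_measure_Diff) auto
    \<comment> \<open>A continuous cutoff with values on the segment from 1 to 0, hence real and
      between 0 and 1. It agrees with the indicator of \<open>B\<close> on \<open>C\<close> and off
      \<open>U\<close>, so the two differ only on \<open>U - C\<close>, by at most 1.\<close>
    obtain h :: "'a \<Rightarrow> complex" where h: "continuous_on UNIV h" "\<And>x. h x \<in> closed_segment 1 0"
        "\<And>x. x \<in> C \<Longrightarrow> h x = 1" "\<And>x. x \<in> - U \<Longrightarrow> h x = 0"
      using Urysohn[of C "- U" "1::complex" 0] C U by (auto simp: compact_imp_closed)
    have hc: "continuous_on UNIV (\<lambda>x. h x * c)" by (intro continuous_intros h)
    have le: "cmod (indicator B x *\<^sub>R c - h x * c) \<le> indicator (U - C) x * cmod c" for x
    proof -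
      obtain t where t: "0 \<le> t" "t \<le> 1" "h x = of_real (1 - t)"
        using h(2)[of x] by (auto simp: closed_segment_def scaleR_conv_of_real)
      have "indicator B x *\<^sub>R c - h x * c = of_real (indicator B x - (1 - t)) * c"
        by (simp add: t scaleR_conv_of_real left_diff_distrib)
      then have n: "cmod (indicator B x *\<^sub>R c - h x * c) = \<bar>indicator B x - (1 - t)\<bar> * cmod c"
        by (simp only: norm_mult norm_of_real)
      have "\<bar>indicator B x - (1 - t)\<bar> \<le> (indicator (U - C) x :: real)"
        using h(3)[of x] h(4)[of x] t C(1) U(1) by (auto simp: indicator_def of_real_eq_1_iff)
      then show ?thesis unfolding n by (rule mult_right_mono) simp
    qed
    have hV: "(\<lambda>x. h x * c) \<in> V" by (rule V_cont[OF hc])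
    have L: "(\<lambda>x. indicator B x *\<^sub>R c - h x * c) \<in> L2_space M"
      using hV \<open>(\<lambda>x. indicator B x *\<^sub>R c) \<in> L2_space M\<close> by (auto simp: V_def intro: L2_space_diff)
    have "(L2_seminorm M (\<lambda>x. indicator B x *\<^sub>R c - h x * c))\<^sup>2 \<le> (LINT x|M. indicator (U - C) x * (cmod c)\<^sup>2)"
      unfolding L2_seminorm_power2
    proof (rule integral_mono)
      show "(cmod (indicator B x *\<^sub>R c - h x * c))\<^sup>2 \<le> indicator (U - C) x * (cmod c)\<^sup>2" for x
      proof -
        have "(indicator (U - C) x * cmod c)\<^sup>2 = indicator (U - C) x * (cmod c)\<^sup>2"
          by (simp add: indicator_def)
        then show ?thesis using power_mono[OF le[of x], of 2] by simp
      qed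
    qed (use L in \<open>auto simp: L2_space_def less_top[symmetric]\<close>)
    also have "\<dots> = measure M (U - C) * (cmod c)\<^sup>2" by simp
    also have "\<dots> \<le> (2 * d) * (cmod c)\<^sup>2" using UC by (intro mult_right_mono) auto
    also have "\<dots> = (e * (cmod c / (cmod c + 1)))\<^sup>2" by (simp add: d_def power_divide power_mult_distrib)
    finally have "L2_seminorm M (\<lambda>x. indicator B x *\<^sub>R c - h x * c) \<le> e * (cmod c / (cmod c + 1))"
      by (rule power2_le_imp_le) (use e in simp)
    also have "\<dots> < e" using e \<open>cmod c + 1 > 0\<close> by (simp add: divide_simps)
    finally show "\<exists>h\<in>V. L2_seminorm M (\<lambda>x. indicator B x *\<^sub>R c - h x) < e"
      by (rule bexI[OF _ hV])
  qed
  have V_zero: "(\<lambda>x. 0) \<in> V" by (rule V_cont) simp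
  have V_sum: "(\<lambda>x. \<Sum>i\<in>I. u i x) \<in> V" if "\<And>i. i \<in> I \<Longrightarrow> u i \<in> V" for I and u :: "complex \<Rightarrow> 'a \<Rightarrow> complex"
    using that by (induction I rule: infinite_finite_induct) (auto intro: V_add V_zero)
  have V_simple: "s \<in> V" if s: "simple_function M s" for s :: "'a \<Rightarrow> complex"
  proof -
    have "(\<lambda>x. \<Sum>y\<in>s ` space M. indicator (s -` {y} \<inter> space M) x *\<^sub>R y) \<in> V"
      using simple_functionD(2)[OF s] sets by (intro V_sum V_ind) auto
    also have "(\<lambda>x. \<Sum>y\<in>s ` space M. indicator (s -` {y} \<inter> space M) x *\<^sub>R y) = s"
      by (rule ext, rule simple_function_indicator_representation_banach[OF s, symmetric]) (simp add: sp)
    finally show ?thesis .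
  qed
  have "g \<in> V"
  proof (rule V_lim[OF g])
    fix e :: real assume e: "e > 0"
    have gm [measurable]: "g \<in> borel_measurable M" and gi: "integrable M (\<lambda>x. (cmod (g x))\<^sup>2)" using g by (auto simp: L2_space_def)
    obtain s where s: "\<And>i. simple_function M (s i)" "\<And>x. (\<lambda>i. s i x) \<longlonglongrightarrow> g x"
        \<comment> \<open>The factor 2 gives |g - s_i| \<le> 3 |g|, whence the dominating function 9
          |g|^2 below.\<close>
        "\<And>i x. cmod (s i x) \<le> 2 * cmod (g x)"
      using borel_measurable_implies_sequence_metric[OF gm, of 0] by (auto simp: sp)
    have sm [measurable]: "s i \<in> borel_measurable M" for i
      using s(1) by (rule borel_measurable_simple_function)
    have "(\<lambda>i. LINT x|M. (cmod (g x - s i x))\<^sup>2) \<longlonglongrightarrow> (LINT x|M. 0)"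
    proof (rule integral_dominated_convergence)
      show "integrable M (\<lambda>x. 9 * (cmod (g x))\<^sup>2)" using gi by simp
      have "(\<lambda>i. (cmod (g x - s i x))\<^sup>2) \<longlonglongrightarrow> (cmod (g x - g x))\<^sup>2" for x by (intro tendsto_intros s)
      then show "AE x in M. (\<lambda>i. (cmod (g x - s i x))\<^sup>2) \<longlonglongrightarrow> 0" by simp
      have "(cmod (g x - s i x))\<^sup>2 \<le> (3 * cmod (g x))\<^sup>2" for i x
        using norm_triangle_ineq4[of "g x" "s i x"] s(3)[of i x] by (intro power_mono) auto
      then show "AE x in M. norm ((cmod (g x - s i x))\<^sup>2) \<le> 9 * (cmod (g x))\<^sup>2" for i
        by (simp add: power_mult_distrib)
    qed measurable
    then have "(\<lambda>i. L2_seminorm M (\<lambda>x. g x - s i x)) \<longlonglongrightarrow> 0"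
      unfolding L2_seminorm_def by (auto intro: tendsto_real_sqrt[where x=0, simplified])
    then obtain i where "L2_seminorm M (\<lambda>x. g x - s i x) < e"
      using e by (metis (no_types, lifting) LIMSEQ_D abs_of_nonneg diff_zero L2_seminorm_nonneg le_refl real_norm_def)
    then show "\<exists>h\<in>V. L2_seminorm M (\<lambda>x. g x - h x) < e" using V_simple[OF s(1)] by blast
  qed
  then show ?thesis using e by (auto simp: V_def)
qed

section \<open>Derivatives of periodic functions\<close>

text \<open>The cell moved by a v is \<open>C2\<close> together with \<open>C3\<close>; moving
  \<open>C3\<close> back by the period v turns it into \<open>C1\<close>, and \<open>C1\<close> and
  \<open>C2\<close> make up the original cell. The cell is described by two functionals
  \<open>p\<close> and \<open>q\<close>, so that exchanging their roles treats the other lattice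
  direction.\<close>

lemma set_integral_shift_periodic:
  fixes F :: "real^2 \<Rightarrow> complex" and p q v :: "real^2"
  defines "C \<equiv> {x. 0 \<le> p \<bullet> x \<and> p \<bullet> x < 1 \<and> 0 \<le> q \<bullet> x \<and> q \<bullet> x < 1}"
  assumes pq: "p \<bullet> v = 1" "q \<bullet> v = 0" and C: "bounded C"
    and F [measurable]: "F \<in> borel_measurable borel" and bd: "\<And>x. cmod (F x) \<le> B"
    and inv: "\<And>x. F (x + v) = F x" and a: "0 \<le> a" "a \<le> 1"
  shows "(LINT x:C|lborel. F (x + a *\<^sub>R v)) = (LINT x:C|lborel. F x)"
proof -
  have shift: "(LINT x|lborel. G (c + x)) = (LINT x|lborel. G x)" if [measurable]: "G \<in> borel_measurable borel"
    for G :: "real^2 \<Rightarrow> complex" and c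
    by (subst (2) lborel_distr_plus[of c, symmetric]) (simp add: integral_distr)
  have int: "integrable lborel (\<lambda>x. indicator D x *\<^sub>R F x)" if "bounded D" and [measurable]: "D \<in> sets borel" for D
  proof (rule Bochner_Integration.integrable_bound)
    have "emeasure lborel D < \<infinity>" using that by (intro emeasure_bounded_finite)
    then show "integrable lborel (\<lambda>x. B * indicator D x)" by simp
    show "AE x in lborel. norm (indicator D x *\<^sub>R F x) \<le> norm (B * indicator D x)"
      using bd order_trans[OF bd abs_ge_self] by (auto simp: indicator_def)
  qed measurable
  define C1 where "C1 = {x. 0 \<le> p \<bullet> x \<and> p \<bullet> x < a \<and> 0 \<le> q \<bullet> x \<and> q \<bullet> x < 1}"
  define C2 where "C2 = {x. a \<le> p \<bullet> x \<and> p \<bullet> x < 1 \<and> 0 \<le> q \<bullet> x \<and> q \<bullet> x < 1}"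
  define C3 where "C3 = {x. 1 \<le> p \<bullet> x \<and> p \<bullet> x < 1 + a \<and> 0 \<le> q \<bullet> x \<and> q \<bullet> x < 1}"
  have [measurable]: "C \<in> sets borel" "C1 \<in> sets borel" "C2 \<in> sets borel" "C3 \<in> sets borel"
    unfolding C_def C1_def C2_def C3_def by measurable
  have sub: "C1 \<subseteq> C" "C2 \<subseteq> C" "C3 \<subseteq> (+) v ` C" using a pq
    by (auto simp: C_def C1_def C2_def C3_def inner_right_distrib inner_diff_right intro!: image_eqI[of _ "(+) v" "_ - v"])
  have bds: "bounded C1" "bounded C2" "bounded C3"
    using bounded_subset[OF C] sub bounded_subset[OF bounded_translation[OF C, of v]] by auto
  have "(LINT x:C|lborel. F (x + a *\<^sub>R v))
      = (LINT x|lborel. indicator C (a *\<^sub>R v + x - a *\<^sub>R v) *\<^sub>R F (a *\<^sub>R v + x))"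
    by (simp add: set_lebesgue_integral_def add.commute)
  also have "\<dots> = (LINT x|lborel. indicator C (x - a *\<^sub>R v) *\<^sub>R F x)"
    by (rule shift) measurable
  also have "\<dots> = (LINT x|lborel. indicator C2 x *\<^sub>R F x + indicator C3 x *\<^sub>R F x)"
    by (rule Bochner_Integration.integral_cong)
      (use pq a in \<open>auto simp: C_def C2_def C3_def indicator_def inner_diff_right\<close>)
  also have "\<dots> = (LINT x|lborel. indicator C2 x *\<^sub>R F x) + (LINT x|lborel. indicator C3 x *\<^sub>R F x)"
    using int bds by (intro Bochner_Integration.integral_add) auto
  also have "(LINT x|lborel. indicator C3 x *\<^sub>R F x) = (LINT x|lborel. indicator C3 (v + x) *\<^sub>R F (v + x))"
    by (rule shift[symmetric]) measurable
  also have "\<dots> = (LINT x|lborel. indicator C1 x *\<^sub>R F x)"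
    by (rule Bochner_Integration.integral_cong)
      (use pq a inv in \<open>auto simp: C1_def C3_def indicator_def inner_add_right add.commute[of v]\<close>)
  also have "(LINT x|lborel. indicator C2 x *\<^sub>R F x) + (LINT x|lborel. indicator C1 x *\<^sub>R F x)
      = (LINT x|lborel. indicator C2 x *\<^sub>R F x + indicator C1 x *\<^sub>R F x)"
    using int bds by (intro Bochner_Integration.integral_add[symmetric]) auto
  also have "\<dots> = (LINT x:C|lborel. F x)"
    unfolding set_lebesgue_integral_def by (rule Bochner_Integration.integral_cong)
      (use a in \<open>auto simp: C_def C2_def C1_def indicator_def\<close>)
  finally show ?thesis .
qed

lemma has_vector_derivative_along:
  assumes "\<phi> differentiable (at (x + t *\<^sub>R v))"
  shows "((\<lambda>s. \<phi> (x + s *\<^sub>R v)) has_vector_derivative frechet_derivative \<phi> (at (x + t *\<^sub>R v)) v) (at t)"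
proof -
  let ?D = "frechet_derivative \<phi> (at (x + t *\<^sub>R v))"
  have D: "(\<phi> has_derivative ?D) (at (x + t *\<^sub>R v))" using assms frechet_derivative_works by blast
  have "((\<lambda>s. x + s *\<^sub>R v) has_derivative (\<lambda>s. s *\<^sub>R v)) (at t)"
    by (auto intro!: derivative_eq_intros)
  from diff_chain_at[OF this D] have "((\<lambda>s. \<phi> (x + s *\<^sub>R v)) has_derivative (\<lambda>s. ?D (s *\<^sub>R v))) (at t)"
    by (simp add: o_def)
  then show ?thesis
    using linear_scale[OF has_derivative_linear[OF D]] by (simp add: has_vector_derivative_def)
qed

lemma has_vector_derivative_imp_quotient:
  fixes x v :: "'a::real_vector"
  assumes "((\<lambda>s. \<phi> (x + s *\<^sub>R v)) has_vector_derivative d) (at 0)"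
  shows "((\<lambda>h. (\<phi> (x + h *\<^sub>R v) - \<phi> x) /\<^sub>R h) \<longlongrightarrow> d) (at 0)"
proof -
  have "((\<lambda>h. norm (\<phi> (x + h *\<^sub>R v) - \<phi> x - h *\<^sub>R d) / norm h) \<longlongrightarrow> 0) (at 0)"
    using assms by (simp add: has_vector_derivative_def has_derivative_at)
  then have "((\<lambda>h. norm ((\<phi> (x + h *\<^sub>R v) - \<phi> x) /\<^sub>R h - d)) \<longlongrightarrow> 0) (at 0)"
  proof (rule Lim_transform_eventually)
    have "norm (\<phi> (x + h *\<^sub>R v) - \<phi> x - h *\<^sub>R d) / norm h = norm ((\<phi> (x + h *\<^sub>R v) - \<phi> x) /\<^sub>R h - d)"
      if "h \<noteq> 0" for h
    proof -
      have "(\<phi> (x + h *\<^sub>R v) - \<phi> x) /\<^sub>R h - d = (\<phi> (x + h *\<^sub>R v) - \<phi> x - h *\<^sub>R d) /\<^sub>R h"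
        using that by (simp add: scaleR_diff_right)
      then show ?thesis by (simp add: divide_inverse mult.commute)
    qed
    then show "\<forall>\<^sub>F h in at 0. norm (\<phi> (x + h *\<^sub>R v) - \<phi> x - h *\<^sub>R d) / norm h
        = norm ((\<phi> (x + h *\<^sub>R v) - \<phi> x) /\<^sub>R h - d)"
      by (auto simp: eventually_at_filter)
  qed
  then show ?thesis by (simp add: tendsto_norm_zero_iff LIM_zero_iff)
qed

text \<open>Difference quotients along the period v have integral zero by shift invariance. They
  converge pointwise to the derivative and are dominated through the mean value inequality, so the
  limit has integral zero too.\<close>

lemma set_integral_periodic_derivative:
  fixes \<phi> :: "real^2 \<Rightarrow> complex" and p q v :: "real^2"
  defines "C \<equiv> {x. 0 \<le> p \<bullet> x \<and> p \<bullet> x < 1 \<and> 0 \<le> q \<bullet> x \<and> q \<bullet> x < 1}"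
  assumes pq: "p \<bullet> v = 1" "q \<bullet> v = 0" and C: "bounded C"
    and diff: "\<And>x. \<phi> differentiable (at x)" and bd0: "\<And>x. cmod (\<phi> x) \<le> B0"
    and cont: "continuous_on UNIV (\<lambda>x. frechet_derivative \<phi> (at x) v)"
    and bd: "\<And>x. cmod (frechet_derivative \<phi> (at x) v) \<le> B"
    and inv: "\<And>x. \<phi> (x + v) = \<phi> x"
  shows "(LINT x:C|lborel. frechet_derivative \<phi> (at x) v) = 0"
proof -
  have [measurable]: "C \<in> sets borel" unfolding C_def by measurable
  have [measurable]: "\<phi> \<in> borel_measurable borel"
    by (intro borel_measurable_continuous_onI continuous_at_imp_continuous_on ballI
        differentiable_imp_continuous_within diff)
  have [measurable]: "(\<lambda>x. frechet_derivative \<phi> (at x) v) \<in> borel_measurable borel"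
    using cont by (rule borel_measurable_continuous_onI)
  \<comment> \<open>Step sizes in (0,1], the range for which shift invariance of the integral was
    shown.\<close>
  define a where "a n = 1 / (real n + 1)" for n :: nat
  have a: "0 < a n" "a n \<le> 1" for n by (auto simp: a_def)
  have alim: "a \<longlonglongrightarrow> 0" unfolding a_def[abs_def] using LIMSEQ_inverse_real_of_nat by (simp only: inverse_eq_divide of_nat_Suc add.commute)
  have fin: "emeasure lborel C < \<infinity>" by (intro emeasure_bounded_finite C)
  have Cint: "integrable lborel (\<lambda>x. indicator C x *\<^sub>R \<phi> (x + c))" for c
  proof (rule Bochner_Integration.integrable_bound)
    show "integrable lborel (\<lambda>x. B0 * indicator C x)" using fin by simp
    show "AE x in lborel. norm (indicator C x *\<^sub>R \<phi> (x + c)) \<le> norm (B0 * indicator C x)"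
      using order_trans[OF bd0 abs_ge_self] by (auto simp: indicator_def)
  qed measurable
  define d where "d n x = (\<phi> (x + a n *\<^sub>R v) - \<phi> x) /\<^sub>R a n" for n x
  have [measurable]: "d n \<in> borel_measurable borel" for n unfolding d_def by measurable
  have "(\<lambda>n. LINT x|lborel. indicator C x *\<^sub>R d n x) \<longlonglongrightarrow>
      (LINT x|lborel. indicator C x *\<^sub>R frechet_derivative \<phi> (at x) v)"
  proof (rule integral_dominated_convergence)
    show "integrable lborel (\<lambda>x. B * indicator C x)" using fin by simp
    have "(\<lambda>n. d n x) \<longlonglongrightarrow> frechet_derivative \<phi> (at x) v" for x
    proof -
      have "((\<lambda>s. \<phi> (x + s *\<^sub>R v)) has_vector_derivative frechet_derivative \<phi> (at x) v) (at 0)"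
        using has_vector_derivative_along[of \<phi> x 0 v] diff by simp
      then have "((\<lambda>h. (\<phi> (x + h *\<^sub>R v) - \<phi> x) /\<^sub>R h) \<longlongrightarrow> frechet_derivative \<phi> (at x) v) (at 0)"
        by (rule has_vector_derivative_imp_quotient)
      moreover have "filterlim a (at 0) sequentially"
        using alim a by (auto simp: filterlim_at intro!: always_eventually) (metis less_irrefl)
      ultimately show ?thesis unfolding d_def by (rule filterlim_compose)
    qed
    then show "AE x in lborel. (\<lambda>n. indicator C x *\<^sub>R d n x) \<longlonglongrightarrow> indicator C x *\<^sub>R frechet_derivative \<phi> (at x) v"
      by (intro AE_I2 tendsto_intros)
    \<comment> \<open>Mean value inequality on the segment from x to x + a_n v; a constant is an
      integrable bound because the cell is bounded.\<close>
    have "cmod (d n x) \<le> B" for n x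
    proof -
      have "cmod (\<phi> (x + a n *\<^sub>R v) - \<phi> (x + 0 *\<^sub>R v)) \<le> B * a n - B * 0"
      proof (rule differentiable_bound_general[OF a(1)])
        show "continuous_on {0..a n} (\<lambda>s. \<phi> (x + s *\<^sub>R v))"
          by (intro continuous_at_imp_continuous_on ballI
              has_vector_derivative_continuous[OF has_vector_derivative_along[OF diff]])
      qed (auto intro!: has_vector_derivative_along diff bd derivative_eq_intros continuous_intros)
      then show ?thesis using a[of n] by (simp add: d_def divide_simps mult.commute)
    qed
    then show "AE x in lborel. norm (indicator C x *\<^sub>R d n x) \<le> B * indicator C x" for n
      by (auto simp: indicator_def)
  qed measurable
  moreover have "(LINT x|lborel. indicator C x *\<^sub>R d n x) = 0" for n
  proof -
    have "(LINT x|lborel. indicator C x *\<^sub>R d n x)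
        = (LINT x|lborel. (indicator C x *\<^sub>R \<phi> (x + a n *\<^sub>R v) - indicator C x *\<^sub>R \<phi> x) /\<^sub>R a n)"
      by (simp add: d_def scaleR_diff_right mult.commute)
    also have "\<dots> = ((LINT x:C|lborel. \<phi> (x + a n *\<^sub>R v)) - (LINT x:C|lborel. \<phi> x)) /\<^sub>R a n"
      using Cint[of "a n *\<^sub>R v"] Cint[of 0] by (simp add: set_lebesgue_integral_def)
    also have "\<dots> = 0"
      using set_integral_shift_periodic[OF pq, of \<phi> B0 "a n"] C bd0 inv a[of n]
      by (simp add: C_def)
    finally show ?thesis .
  qed
  ultimately show ?thesis
    by (simp add: set_lebesgue_integral_def LIMSEQ_const_iff)
qed

section \<open>The flat torus\<close>

lemma cont_diff_imp_continuous: "cont_diff k u \<Longrightarrow> continuous_on UNIV u"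
  by (cases k) (auto intro!: continuous_at_imp_continuous_on differentiable_imp_continuous_within)

lemma frechet_derivative_lattice_invariant:
  assumes "lattice_invariant L u" "\<And>x. u differentiable (at x)"
  shows "lattice_invariant L (\<lambda>x. frechet_derivative u (at x) e)"
  unfolding lattice_invariant_def
proof safe
  fix x l assume l: "l \<in> L"
  have "((\<lambda>x. x + l) has_derivative (\<lambda>h. h)) (at x)"
    by (auto intro!: derivative_eq_intros)
  moreover have "(u has_derivative frechet_derivative u (at (x + l))) (at (x + l))"
    using assms(2) frechet_derivative_works by blast
  ultimately have "(u \<circ> (\<lambda>x. x + l) has_derivative frechet_derivative u (at (x + l)) \<circ> (\<lambda>h. h)) (at x)"
    by (rule diff_chain_at)
  moreover have "u \<circ> (\<lambda>x. x + l) = u" using assms(1) l by (auto simp: lattice_invariant_def fun_eq_iff)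
  ultimately have "(u has_derivative frechet_derivative u (at (x + l))) (at x)" by (simp add: o_def)
  then show "frechet_derivative u (at (x + l)) e = frechet_derivative u (at x) e"
    using frechet_derivative_at by fastforce
qed

text \<open>\<open>fundamental_cell\<close> picks its basis by \<open>SOME\<close>. The locale fixes
  exactly such a basis, and \<open>cell\<close> ties the picked cell to it, so that the choice never
  has to be opened again.\<close>

locale flat_torus =
  fixes L :: "(real^2) set" and v w :: "real^2"
  assumes basis: "lattice_basis L v w"
    and cell: "fundamental_cell L = {s *\<^sub>R v + t *\<^sub>R w | s t. 0 \<le> s \<and> s < 1 \<and> 0 \<le> t \<and> t < 1}"
begin

section \<open>Dual basis, fundamental cell and its measure\<close>

definition area :: real where "area = v$1 * w$2 - v$2 * w$1"

text \<open>\<open>v'\<close> and \<open>w'\<close> are the rows of the inverse of the matrix with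
  columns \<open>v\<close> and \<open>w\<close>, whose determinant is the signed
  \<open>area\<close>. They read off the coordinates in the lattice basis, and they also serve as a
  basis of the dual lattice.\<close>

definition v' :: "real^2" where "v' = vector [w$2, - w$1] /\<^sub>R area"
definition w' :: "real^2" where "w' = vector [- v$2, v$1] /\<^sub>R area"

lemma area_nonzero: "area \<noteq> 0"
proof
  assume 0: "area = 0"
  have "v \<noteq> w" "independent {v, w}" using basis by (auto simp: lattice_basis_def)
  then have ind: "v \<notin> span {w}" "w \<noteq> 0"
    by (auto simp: independent_insert)
  from ind(2) obtain i where i: "w $ i \<noteq> 0" by (auto simp: vec_eq_iff)
  \<comment> \<open>A vanishing determinant makes the two vectors proportional; the ratio is read
    off in a coordinate where \<open>w\<close> does not vanish.\<close>
  have "v = (v $ i / w $ i) *\<^sub>R w"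
    using i 0 exhaust_2[of i] by (auto simp: vec_eq_iff forall_2 area_def field_simps)
  then show False using ind(1) by (metis span_base span_scale singletonI)
qed

lemma inner_v': "v' \<bullet> x = (w$2 * x$1 - w$1 * x$2) / area"
  by (simp add: v'_def inner_vec_def sum_2 divide_inverse algebra_simps)

lemma inner_w': "w' \<bullet> x = (v$1 * x$2 - v$2 * x$1) / area"
  by (simp add: w'_def inner_vec_def sum_2 divide_inverse algebra_simps)

lemma dual_basis:
  "v' \<bullet> v = 1" "v' \<bullet> w = 0" "w' \<bullet> v = 0" "w' \<bullet> w = 1"
  using area_nonzero by (auto simp: inner_v' inner_w' divide_simps) (auto simp: area_def)

lemma basis_expansion: "x = (v' \<bullet> x) *\<^sub>R v + (w' \<bullet> x) *\<^sub>R w"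
  using area_nonzero
  by (simp add: inner_v' inner_w' vec_eq_iff forall_2 divide_simps) (simp add: area_def algebra_simps)

lemma fundamental_cell_eq:
  "fundamental_cell L = {x. 0 \<le> v' \<bullet> x \<and> v' \<bullet> x < 1 \<and> 0 \<le> w' \<bullet> x \<and> w' \<bullet> x < 1}"
proof safe
  fix x assume "x \<in> fundamental_cell L"
  then show "0 \<le> v' \<bullet> x" "v' \<bullet> x < 1" "0 \<le> w' \<bullet> x" "w' \<bullet> x < 1"
    by (auto simp: cell inner_add_right dual_basis)
next
  fix x assume "0 \<le> v' \<bullet> x" "v' \<bullet> x < 1" "0 \<le> w' \<bullet> x" "w' \<bullet> x < 1"
  then show "x \<in> fundamental_cell L" using basis_expansion[of x] unfolding cell by blast
qed

lemma mem_lattice_iff: "x \<in> L \<longleftrightarrow> v' \<bullet> x \<in> \<int> \<and> w' \<bullet> x \<in> \<int>"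
proof
  assume "x \<in> L"
  then show "v' \<bullet> x \<in> \<int> \<and> w' \<bullet> x \<in> \<int>"
    using basis by (auto simp: lattice_basis_def inner_add_right dual_basis)
next
  assume "v' \<bullet> x \<in> \<int> \<and> w' \<bullet> x \<in> \<int>"
  then obtain m n where "v' \<bullet> x = of_int m" "w' \<bullet> x = of_int n" by (auto elim!: Ints_cases)
  then have "x = of_int m *\<^sub>R v + of_int n *\<^sub>R w" using basis_expansion[of x] by simp
  then show "x \<in> L" using basis unfolding lattice_basis_def by blast
qed

lemma mem_dual_iff: "p \<in> dual_lattice L \<longleftrightarrow> p \<bullet> v \<in> \<int> \<and> p \<bullet> w \<in> \<int>"
proof
  assume "p \<in> dual_lattice L"
  then show "p \<bullet> v \<in> \<int> \<and> p \<bullet> w \<in> \<int>"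
    by (auto simp: dual_lattice_def mem_lattice_iff dual_basis)
next
  assume "p \<bullet> v \<in> \<int> \<and> p \<bullet> w \<in> \<int>"
  then show "p \<in> dual_lattice L"
    using basis by (auto simp: dual_lattice_def lattice_basis_def inner_add_right)
qed

lemma dual_basis_mem: "v' \<in> dual_lattice L" "w' \<in> dual_lattice L"
  by (auto simp: mem_dual_iff dual_basis)

lemma dual_lattice_add: "p \<in> dual_lattice L \<Longrightarrow> q \<in> dual_lattice L \<Longrightarrow> p + q \<in> dual_lattice L"
  by (auto simp: mem_dual_iff inner_add_left)

lemma dual_lattice_uminus: "p \<in> dual_lattice L \<Longrightarrow> - p \<in> dual_lattice L"
  by (auto simp: mem_dual_iff)

lemma bounded_cell: "bounded (fundamental_cell L)"
proof (rule boundedI)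
  fix x assume "x \<in> fundamental_cell L"
  then obtain s t where x: "x = s *\<^sub>R v + t *\<^sub>R w" "0 \<le> s" "s < 1" "0 \<le> t" "t < 1"
    by (auto simp: cell)
  have "norm x \<le> s * norm v + t * norm w"
    using norm_triangle_ineq[of "s *\<^sub>R v" "t *\<^sub>R w"] x by simp
  also have "\<dots> \<le> 1 * norm v + 1 * norm w"
    using x by (intro add_mono mult_right_mono) auto
  finally show "norm x \<le> norm v + norm w" by simp
qed

lemma cell_borel [measurable]: "fundamental_cell L \<in> sets borel"
  unfolding fundamental_cell_eq by measurable

text \<open>Lebesgue measure restricted by a density rather than to a subspace: the underlying space
  stays the whole plane and the measurable sets stay the Borel sets, so functions on the plane need
  no restriction.\<close>

definition cell_measure :: "(real^2) measure" where
  "cell_measure = density lborel (\<lambda>x. ennreal (indicator (fundamental_cell L) x))"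

lemma sets_cell_measure [measurable_cong, simp]: "sets cell_measure = sets borel"
  by (simp add: cell_measure_def)

lemma space_cell_measure [simp]: "space cell_measure = UNIV"
  by (simp add: cell_measure_def)

lemma emeasure_cell_measure: "emeasure cell_measure UNIV = emeasure lborel (fundamental_cell L)"
  by (simp add: cell_measure_def emeasure_density ennreal_indicator)

sublocale cell: finite_measure cell_measure
proof
  show "emeasure cell_measure (space cell_measure) \<noteq> \<infinity>"
    using emeasure_bounded_finite[OF bounded_cell] by (simp add: emeasure_cell_measure)
qed

text \<open>The open parallelogram inside the cell is nonempty. This keeps the characters from being
  null vectors, which is what makes their eigenvalues spectral values.\<close>

lemma measure_cell_pos: "measure cell_measure UNIV > 0"
proof -
  define U where "U = {x. 0 < v' \<bullet> x} \<inter> {x. v' \<bullet> x < 1} \<inter> ({x. 0 < w' \<bullet> x} \<inter> {x. w' \<bullet> x < 1})"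
  have "open U" unfolding U_def
    by (intro open_Int open_halfspace_lt open_Collect_less continuous_intros)
  moreover have "(1/2) *\<^sub>R v + (1/2) *\<^sub>R w \<in> U" by (simp add: U_def inner_add_right dual_basis)
  ultimately have "\<not> negligible U" by (intro open_not_negligible) auto
  moreover have "U \<subseteq> fundamental_cell L" by (auto simp: U_def fundamental_cell_eq)
  ultimately have "\<not> negligible (fundamental_cell L)" using negligible_subset by blast
  then have "fundamental_cell L \<notin> null_sets lborel"
    using null_sets_completionI[of _ lborel] by (auto simp: negligible_iff_null_sets)
  then have "emeasure cell_measure UNIV \<noteq> 0"
    unfolding emeasure_cell_measure by (auto simp: null_sets_def)
  then show ?thesis by (simp add: cell.emeasure_eq_measure zero_less_measure_iff)
qed

lemma set_integral_cell:
  fixes F :: "real^2 \<Rightarrow> 'b::{banach, second_countable_topology}"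
  assumes "F \<in> borel_measurable borel"
  shows "(LINT x:fundamental_cell L|lborel. F x) = integral\<^sup>L cell_measure F"
  using assms unfolding cell_measure_def set_lebesgue_integral_def
  by (intro integral_density[symmetric]) auto

lemma set_integrable_cell:
  fixes F :: "real^2 \<Rightarrow> 'b::{banach, second_countable_topology}"
  assumes "F \<in> borel_measurable borel"
  shows "set_integrable lborel (fundamental_cell L) F \<longleftrightarrow> integrable cell_measure F"
  using assms unfolding cell_measure_def set_integrable_def
  by (intro integrable_density[symmetric]) auto

lemma borel_measurable_cell: "borel_measurable cell_measure = borel_measurable borel"
  by (rule measurable_cong_sets) auto

lemma L2_torus_iff: "u \<in> L2_torus L \<longleftrightarrow> lattice_invariant L u \<and> u \<in> L2_space cell_measure"
  unfolding L2_torus_def L2_space_def borel_measurable_cell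
  using set_integrable_cell[of "\<lambda>x. (cmod (u x))\<^sup>2"] by auto

lemma l2_norm_eq: "u \<in> borel_measurable borel \<Longrightarrow> l2_norm L u = L2_seminorm cell_measure u"
  unfolding l2_norm_def L2_seminorm_def by (simp add: set_integral_cell)

lemma l2_norm_L2: "u \<in> L2_space cell_measure \<Longrightarrow> l2_norm L u = L2_seminorm cell_measure u"
  using L2_spaceD(1)[of u cell_measure] by (intro l2_norm_eq) (simp add: borel_measurable_cell)

lemma lattice_translate_into_cell: "\<exists>l\<in>L. x + l \<in> fundamental_cell L"
proof (rule bexI)
  let ?l = "of_int (- \<lfloor>v' \<bullet> x\<rfloor>) *\<^sub>R v + of_int (- \<lfloor>w' \<bullet> x\<rfloor>) *\<^sub>R w"
  show "?l \<in> L" using basis unfolding lattice_basis_def by blast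
  show "x + ?l \<in> fundamental_cell L"
    by (auto simp: fundamental_cell_eq inner_add_right inner_diff_right dual_basis) linarith+
qed

text \<open>Compactness of the torus in disguise: every point has a lattice translate in the cell,
  whose closure is compact.\<close>

lemma invariant_bounded:
  fixes u :: "real^2 \<Rightarrow> complex"
  assumes "lattice_invariant L u" "continuous_on UNIV u"
  obtains B where "\<And>x. cmod (u x) \<le> B"
proof -
  have "compact (u ` closure (fundamental_cell L))"
    by (intro compact_continuous_image continuous_on_subset[OF assms(2)]) (auto simp: bounded_cell)
  then obtain B where B: "\<And>x. x \<in> closure (fundamental_cell L) \<Longrightarrow> cmod (u x) \<le> B"
    using compact_imp_bounded by (force simp: bounded_iff)
  have "cmod (u x) \<le> B" for x
  proof -
    obtain l where "l \<in> L" "x + l \<in> fundamental_cell L" using lattice_translate_into_cell by blast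
    then show ?thesis using B[of "x + l"] closure_subset assms(1) by (auto simp: lattice_invariant_def)
  qed
  then show ?thesis by (rule that)
qed

lemma invariant_continuous_L2:
  assumes "lattice_invariant L u" "continuous_on UNIV u"
  shows "u \<in> L2_space cell_measure"
proof -
  obtain B where B: "\<And>x. cmod (u x) \<le> B" using invariant_bounded[OF assms] by blast
  show ?thesis
    by (rule cell.bounded_L2_space[of _ B])
       (use B borel_measurable_continuous_onI[OF assms(2)] in \<open>auto simp: borel_measurable_cell\<close>)
qed

lemma basis_mem: "v \<in> L" "w \<in> L"
  by (auto simp: mem_lattice_iff dual_basis)

text \<open>A derivative is linear in its direction, and \<open>v\<close> and \<open>w\<close> span
  the plane; for these two periods the integral vanishes by shift invariance.\<close>

lemma integral_derivative_zero:
  assumes inv: "lattice_invariant L \<phi>" and C1: "cont_diff 1 \<phi>"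
  shows "(LINT x|cell_measure. frechet_derivative \<phi> (at x) e) = 0"
proof -
  let ?D = "\<lambda>e x. frechet_derivative \<phi> (at x) e"
  have diff: "\<phi> differentiable (at x)" for x using C1 by simp
  have cont: "continuous_on UNIV (?D e)" for e using C1 by simp
  have Dinv: "lattice_invariant L (?D e)" for e
    by (rule frechet_derivative_lattice_invariant[OF inv diff])
  obtain B0 where B0: "\<And>x. cmod (\<phi> x) \<le> B0"
    using invariant_bounded[OF inv cont_diff_imp_continuous[OF C1]] by blast
  have L: "?D e \<in> L2_space cell_measure" for e by (rule invariant_continuous_L2[OF Dinv cont])
  have int: "integrable cell_measure (?D e)" for e by (rule cell.L2_imp_integrable[OF L])
  \<comment> \<open>The same cell with the two functionals exchanged, which matches the integral
    lemma for the direction \<open>w\<close>.\<close>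
  have sw: "fundamental_cell L = {x. 0 \<le> w' \<bullet> x \<and> w' \<bullet> x < 1 \<and> 0 \<le> v' \<bullet> x \<and> v' \<bullet> x < 1}"
    by (auto simp: fundamental_cell_eq)
  have m: "?D e \<in> borel_measurable borel" for e by (rule borel_measurable_continuous_onI[OF cont])
  have v: "(LINT x|cell_measure. ?D v x) = 0"
  proof -
    obtain B where "\<And>x. cmod (?D v x) \<le> B" using invariant_bounded[OF Dinv cont] by blast
    then show ?thesis
      using set_integral_periodic_derivative[of v' v w' \<phi> B0 B] bounded_cell diff B0 cont inv basis_mem
      by (simp add: set_integral_cell[OF m] dual_basis lattice_invariant_def flip: fundamental_cell_eq)
  qed
  have w: "(LINT x|cell_measure. ?D w x) = 0"
  proof -
    obtain B where "\<And>x. cmod (?D w x) \<le> B" using invariant_bounded[OF Dinv cont] by blast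
    then show ?thesis
      using set_integral_periodic_derivative[of w' w v' \<phi> B0 B] bounded_cell diff B0 cont inv basis_mem
      by (simp add: set_integral_cell[OF m] dual_basis lattice_invariant_def flip: sw)
  qed
  have lin: "linear (\<lambda>e. ?D e x)" for x
    using diff frechet_derivative_works has_derivative_linear by blast
  have "?D e x = (v' \<bullet> e) *\<^sub>R ?D v x + (w' \<bullet> e) *\<^sub>R ?D w x" for x
    by (subst basis_expansion[of e]) (simp add: linear_add[OF lin] linear_scale[OF lin])
  then show ?thesis using int v w by simp
qed

end

text \<open>A basis given by full rank only witnesses that the choice in
  \<open>fundamental_cell\<close> succeeds; the locale is then instantiated with the chosen
  pair.\<close>

lemma full_rank_lattice_flat_torus:
  assumes "full_rank_lattice L"
  obtains v w where "flat_torus L v w"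
proof -
  define b where "b = (SOME (v, w). lattice_basis L v w)"
  obtain v w where vw: "lattice_basis L v w" using assms by (auto simp: full_rank_lattice_def)
  have "case b of (v, w) \<Rightarrow> lattice_basis L v w"
    unfolding b_def by (rule someI[of _ "(v, w)"]) (simp add: vw)
  moreover obtain v' w' where b: "b = (v', w')" by fastforce
  ultimately have "flat_torus L v' w'"
    by unfold_locales (auto simp: fundamental_cell_def b_def[symmetric])
  then show ?thesis by (rule that)
qed

section \<open>Characters and the magnetic Laplacian\<close>

definition torus_char :: "real^2 \<Rightarrow> real^2 \<Rightarrow> complex" where
  "torus_char p x = exp (2 * of_real pi * \<i> * of_real (p \<bullet> x))"

text \<open>Frequencies and coefficients are separate arguments, so that derivatives, the magnetic
  Laplacian and its resolvent act as multipliers on \<open>c\<close> with \<open>S\<close>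
  unchanged.\<close>

definition trig_poly :: "(real^2) set \<Rightarrow> (real^2 \<Rightarrow> complex) \<Rightarrow> real^2 \<Rightarrow> complex" where
  "trig_poly S c x = (\<Sum>p\<in>S. c p * torus_char p x)"

lemma torus_char_add: "torus_char (p + q) x = torus_char p x * torus_char q x"
  by (simp add: torus_char_def inner_add_left ring_distribs exp_add)

lemma torus_char_zero [simp]: "torus_char 0 x = 1"
  by (simp add: torus_char_def)

lemma cnj_torus_char: "cnj (torus_char p x) = torus_char (- p) x"
  by (simp add: torus_char_def exp_cnj)

lemma norm_torus_char [simp]: "cmod (torus_char p x) = 1"
  by (simp add: torus_char_def)

lemma torus_char_has_derivative:
  "(torus_char p has_derivative (\<lambda>h. 2 * of_real pi * \<i> * of_real (p \<bullet> h) * torus_char p x)) (at x)"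
proof -
  have "((\<lambda>x. 2 * of_real pi * \<i> * of_real (p \<bullet> x)) has_derivative
      (\<lambda>h. 2 * of_real pi * \<i> * of_real (p \<bullet> h) :: complex)) (at x)"
    by (intro has_derivative_mult_right has_derivative_of_real has_derivative_inner_right has_derivative_ident)
  from diff_chain_at[OF this DERIV_exp[unfolded has_field_derivative_def]]
  show ?thesis by (simp add: torus_char_def[abs_def] o_def mult_ac)
qed

lemma trig_poly_has_derivative:
  "(trig_poly S c has_derivative
     (\<lambda>h. trig_poly S (\<lambda>p. 2 * of_real pi * \<i> * of_real (p \<bullet> h) * c p) x)) (at x)"
proof -
  have "((\<lambda>x. \<Sum>p\<in>S. c p * torus_char p x) has_derivative
     (\<lambda>h. \<Sum>p\<in>S. c p * (2 * of_real pi * \<i> * of_real (p \<bullet> h) * torus_char p x))) (at x)"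
    by (intro has_derivative_sum has_derivative_mult_right torus_char_has_derivative)
  then show ?thesis unfolding trig_poly_def[abs_def] by (simp add: mult_ac)
qed

lemma frechet_derivative_trig_poly:
  "frechet_derivative (trig_poly S c) (at x) h
    = trig_poly S (\<lambda>p. 2 * of_real pi * \<i> * of_real (p \<bullet> h) * c p) x"
  by (rule fun_cong[OF frechet_derivative_at[OF trig_poly_has_derivative], symmetric])

text \<open>The induction closes because a directional derivative is again a trigonometric
  polynomial over \<open>S\<close>; hence the generalisation over \<open>c\<close>.\<close>

lemma cont_diff_trig_poly: "cont_diff k (trig_poly S c)"
proof (induction k arbitrary: c)
  case 0
  have "isCont (trig_poly S c) x" for x
    using has_derivative_continuous[OF trig_poly_has_derivative] .
  then show ?case by (simp add: continuous_at_imp_continuous_on)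
next
  case (Suc k)
  have "trig_poly S c differentiable (at x)" for x
    using trig_poly_has_derivative by (rule differentiableI)
  then show ?case using Suc by (simp add: frechet_derivative_trig_poly)
qed

lemma torus_char_eq_trig_poly: "torus_char p = trig_poly {p} (\<lambda>_. 1)"
  by (simp add: trig_poly_def fun_eq_iff)

lemma torus_char_lattice_invariant:
  assumes "p \<in> dual_lattice L"
  shows "lattice_invariant L (torus_char p)"
  unfolding lattice_invariant_def
proof safe
  fix x l assume "l \<in> L"
  then have "p \<bullet> l \<in> \<int>" using assms by (simp add: dual_lattice_def)
  then obtain m where m: "p \<bullet> l = of_int m" by (rule Ints_cases)
  have "torus_char p (x + l) = torus_char p x * exp (2 * of_int m * of_real pi * \<i>)"
    unfolding torus_char_def inner_add_right m of_real_add ring_distribs exp_add by (simp add: mult_ac)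
  also have "exp (2 * of_int m * of_real pi * \<i>) = 1"
    using exp_integer_2pi[of "of_int m"] by simp
  finally show "torus_char p (x + l) = torus_char p x" by simp
qed

lemma trig_poly_lattice_invariant:
  assumes "S \<subseteq> dual_lattice L"
  shows "lattice_invariant L (trig_poly S c)"
proof -
  have "torus_char p (x + l) = torus_char p x" if "p \<in> S" "l \<in> L" for p x l
    using torus_char_lattice_invariant[of p L] that assms by (auto simp: lattice_invariant_def)
  then show ?thesis by (simp add: lattice_invariant_def trig_poly_def)
qed

lemma trig_poly_smooth: "S \<subseteq> dual_lattice L \<Longrightarrow> trig_poly S c \<in> smooth_torus L"
  by (simp add: smooth_torus_def trig_poly_lattice_invariant cont_diff_trig_poly)

lemma trig_poly_mult: "trig_poly S c x * a = trig_poly S (\<lambda>p. a * c p) x"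
  by (simp add: trig_poly_def sum_distrib_left sum_distrib_right mult_ac)

section \<open>The magnetic Laplacian with constant potential and its symbol\<close>

lemma magnetic_laplacian_const:
  "magnetic_laplacian (\<lambda>x. a) u x =
     - (\<Sum>k\<in>UNIV. partial_deriv k (partial_deriv k u) x)
     + 2 * \<i> * (\<Sum>k\<in>UNIV. of_real (a $ k) * partial_deriv k u x)
     + of_real ((norm a)\<^sup>2) * u x"
  by (simp add: magnetic_laplacian_def laplacian_def codifferential_def partial_deriv_def)

definition magnetic_eigenvalue :: "real^2 \<Rightarrow> real^2 \<Rightarrow> real" where
  "magnetic_eigenvalue P p = 4 * pi\<^sup>2 * (norm (P - p))\<^sup>2"

text \<open>Completing the square: |p|^2 - 2 P.p + |P|^2 = |P - p|^2, up to the factor 4 \<pi>^2.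
  The free factor \<open>z\<close> allows two uses, with a coefficient of a trigonometric polynomial
  and with a Fourier integral of a smooth function.\<close>

lemma magnetic_symbol:
  fixes P p :: "real^2"
  shows "- (\<Sum>k\<in>UNIV. (2 * of_real pi * \<i> * of_real (p $ k)) * ((2 * of_real pi * \<i> * of_real (p $ k)) * z))
     + 2 * \<i> * (\<Sum>k\<in>UNIV. of_real (((2 * pi) *\<^sub>R P) $ k) * (2 * of_real pi * \<i> * of_real (p $ k) * z))
     + of_real ((norm ((2 * pi) *\<^sub>R P))\<^sup>2) * z = of_real (magnetic_eigenvalue P p) * z"
proof -
  have n: "(norm x)\<^sup>2 = (x $ 1)\<^sup>2 + (x $ 2)\<^sup>2" for x :: "real^2"
    by (simp only: power2_norm_eq_inner inner_vec_def sum_2) (simp add: power2_eq_square)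
  \<comment> \<open>A polynomial identity in which \<open>t\<close> stands for \<pi> and
    \<open>j\<close> for the imaginary unit, of which only the square matters.\<close>
  have alg: "- ((2*t*j*a) * ((2*t*j*a) * z) + (2*t*j*b) * ((2*t*j*b) * z))
      + 2*j * ((2*t*A) * (2*t*j*a*z) + (2*t*B) * (2*t*j*b*z)) + ((2*t*A)\<^sup>2 + (2*t*B)\<^sup>2) * z
      = 4*t\<^sup>2 * ((A - a)\<^sup>2 + (B - b)\<^sup>2) * z" if "j * j = -1" for j t a b A B z :: complex
    using that by algebra
  show ?thesis
    unfolding magnetic_eigenvalue_def n sum_2
    using alg[of \<i> "of_real pi" "of_real (p $ 1)" z "of_real (p $ 2)" "of_real (P $ 1)" "of_real (P $ 2)"]
    by simp
qed

lemma partial_deriv_trig_poly: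
  "partial_deriv k (trig_poly S c) = trig_poly S (\<lambda>p. 2 * of_real pi * \<i> * of_real (p $ k) * c p)"
  by (simp add: partial_deriv_def fun_eq_iff frechet_derivative_trig_poly inner_axis)

lemma magnetic_laplacian_trig_poly:
  "magnetic_laplacian (\<lambda>x. (2 * pi) *\<^sub>R P) (trig_poly S c) x
    = trig_poly S (\<lambda>p. of_real (magnetic_eigenvalue P p) * c p) x"
proof -
  let ?d = "\<lambda>k p. 2 * of_real pi * \<i> * of_real (p $ k) :: complex"
  have "magnetic_laplacian (\<lambda>x. (2 * pi) *\<^sub>R P) (trig_poly S c) x
      = (\<Sum>p\<in>S. (- (\<Sum>k\<in>UNIV. ?d k p * (?d k p * c p))
          + 2 * \<i> * (\<Sum>k\<in>UNIV. of_real (((2 * pi) *\<^sub>R P) $ k) * (?d k p * c p))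
          + of_real ((norm ((2 * pi) *\<^sub>R P))\<^sup>2) * c p) * torus_char p x)"
    unfolding magnetic_laplacian_const partial_deriv_trig_poly trig_poly_def sum_2
    by (simp only: sum.distrib sum_negf sum_distrib_left distrib_left distrib_right mult.assoc minus_add_distrib
        mult_minus_left add.assoc)
  also have "\<dots> = trig_poly S (\<lambda>p. of_real (magnetic_eigenvalue P p) * c p) x"
    unfolding trig_poly_def magnetic_symbol ..
  finally show ?thesis .
qed

section \<open>Fourier coefficients of smooth functions and orthogonality of characters\<close>

context flat_torus
begin

lemma smooth_invariant: "u \<in> smooth_torus L \<Longrightarrow> lattice_invariant L u"
  and smooth_cont_diff: "u \<in> smooth_torus L \<Longrightarrow> cont_diff k u"
  by (auto simp: smooth_torus_def)

lemma smooth_differentiable: "u \<in> smooth_torus L \<Longrightarrow> u differentiable (at x)"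
  using smooth_cont_diff[of u "Suc 0"] by simp

lemma smooth_L2: "u \<in> smooth_torus L \<Longrightarrow> u \<in> L2_space cell_measure"
  by (intro invariant_continuous_L2 smooth_invariant cont_diff_imp_continuous[OF smooth_cont_diff])

lemma smooth_derivative:
  assumes "u \<in> smooth_torus L"
  shows "(\<lambda>x. frechet_derivative u (at x) e) \<in> smooth_torus L"
proof -
  have "cont_diff k (\<lambda>x. frechet_derivative u (at x) e)" for k
    using smooth_cont_diff[OF assms, of "Suc k"] by simp
  then show ?thesis
    using frechet_derivative_lattice_invariant[OF smooth_invariant smooth_differentiable, OF assms assms]
    by (simp add: smooth_torus_def)
qed

lemma smooth_partial_deriv: "u \<in> smooth_torus L \<Longrightarrow> partial_deriv k u \<in> smooth_torus L"
  unfolding partial_deriv_def[abs_def] by (rule smooth_derivative)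

lemma trig_poly_L2: "S \<subseteq> dual_lattice L \<Longrightarrow> trig_poly S c \<in> L2_space cell_measure"
  by (intro smooth_L2 trig_poly_smooth)

lemma torus_char_smooth: "p \<in> dual_lattice L \<Longrightarrow> torus_char p \<in> smooth_torus L"
  unfolding torus_char_eq_trig_poly by (rule trig_poly_smooth) simp

lemma torus_char_L2: "p \<in> dual_lattice L \<Longrightarrow> torus_char p \<in> L2_space cell_measure"
  by (intro smooth_L2 torus_char_smooth)

text \<open>Integration by parts without boundary term: the product of \<open>u\<close> with the
  character is periodic and continuously differentiable, so its derivative has integral
  zero.\<close>

lemma integral_derivative_torus_char:
  assumes u: "u \<in> smooth_torus L" and q: "q \<in> dual_lattice L"
  shows "(LINT x|cell_measure. frechet_derivative u (at x) e * torus_char q x)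
     = - (2 * of_real pi * \<i> * of_real (q \<bullet> e)) * (LINT x|cell_measure. u x * torus_char q x)"
proof -
  let ?c = "2 * of_real pi * \<i> * of_real (q \<bullet> e) :: complex"
  let ?D = "\<lambda>e x. frechet_derivative u (at x) e"
  have D: "((\<lambda>x. u x * torus_char q x) has_derivative (\<lambda>h. u x * (2 * of_real pi * \<i> * of_real (q \<bullet> h) * torus_char q x)
      + ?D h x * torus_char q x)) (at x)" for x
    using smooth_differentiable[OF u, of x] frechet_derivative_works
    by (intro has_derivative_mult torus_char_has_derivative) blast
  have eq: "frechet_derivative (\<lambda>x. u x * torus_char q x) (at x) h
      = u x * (2 * of_real pi * \<i> * of_real (q \<bullet> h) * torus_char q x) + ?D h x * torus_char q x" for x h
    using fun_cong[OF frechet_derivative_at[OF D[of x]], of h] by simp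
  have c: "continuous_on UNIV u" "continuous_on UNIV (torus_char q)" "continuous_on UNIV (?D h)" for h
    using cont_diff_imp_continuous[OF smooth_cont_diff] u torus_char_smooth[OF q] smooth_derivative[OF u]
    by blast+
  have "cont_diff 1 (\<lambda>x. u x * torus_char q x)"
    using D by (auto simp: eq differentiable_def intro!: continuous_intros c)
  moreover have "lattice_invariant L (\<lambda>x. u x * torus_char q x)"
    using smooth_invariant[OF u] torus_char_lattice_invariant[OF q] by (simp add: lattice_invariant_def)
  ultimately have "(LINT x|cell_measure. frechet_derivative (\<lambda>x. u x * torus_char q x) (at x) e) = 0"
    by (intro integral_derivative_zero)
  moreover have "integrable cell_measure (\<lambda>x. u x * torus_char q x)"
    "integrable cell_measure (\<lambda>x. ?D e x * torus_char q x)"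
    using u q by (auto intro!: L2_space_mult_integrable smooth_L2 torus_char_smooth smooth_derivative)
  moreover have "frechet_derivative (\<lambda>x. u x * torus_char q x) (at x) e
      = ?c * (u x * torus_char q x) + ?D e x * torus_char q x" for x
    by (simp add: eq mult_ac)
  ultimately show ?thesis by (simp add: add_eq_0_iff2)
qed

lemma integral_partial_deriv_torus_char:
  assumes "u \<in> smooth_torus L" "p \<in> dual_lattice L"
  shows "(LINT x|cell_measure. partial_deriv k u x * torus_char (- p) x)
     = 2 * of_real pi * \<i> * of_real (p $ k) * (LINT x|cell_measure. u x * torus_char (- p) x)"
  unfolding partial_deriv_def integral_derivative_torus_char[OF assms(1) dual_lattice_uminus[OF assms(2)]]
  by (simp add: inner_axis)

text \<open>Each partial derivative moves onto the character as the factor 2 \<pi> i p_k, and second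
  derivatives do so twice. The result is the symbol computed before, now applied to a Fourier
  integral.\<close>

lemma integral_magnetic_laplacian_torus_char:
  assumes u: "u \<in> smooth_torus L" and p: "p \<in> dual_lattice L"
  shows "(LINT x|cell_measure. magnetic_laplacian (\<lambda>x. (2 * pi) *\<^sub>R P) u x * torus_char (- p) x)
     = of_real (magnetic_eigenvalue P p) * (LINT x|cell_measure. u x * torus_char (- p) x)"
proof -
  have i: "integrable cell_measure (\<lambda>x. f x * torus_char (- p) x)" if "f \<in> smooth_torus L" for f
    using that p by (auto intro!: L2_space_mult_integrable smooth_L2 torus_char_smooth dual_lattice_uminus)
  let ?I = "\<lambda>f. LINT x|cell_measure. f x * torus_char (- p) x"
  let ?a = "(2 * pi) *\<^sub>R P"
  have s: "partial_deriv k u \<in> smooth_torus L" "partial_deriv k (partial_deriv k u) \<in> smooth_torus L" for k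
    using u by (auto intro!: smooth_partial_deriv)
  have "?I (magnetic_laplacian (\<lambda>x. ?a) u) = (LINT x|cell_measure.
      - (\<Sum>k\<in>UNIV. partial_deriv k (partial_deriv k u) x * torus_char (- p) x)
      + 2 * \<i> * (\<Sum>k\<in>UNIV. of_real (?a $ k) * (partial_deriv k u x * torus_char (- p) x))
      + of_real ((norm ?a)\<^sup>2) * (u x * torus_char (- p) x))"
    unfolding magnetic_laplacian_const
    by (rule Bochner_Integration.integral_cong[OF refl]) (simp add: sum_2 algebra_simps)
  also have "\<dots> = - (\<Sum>k\<in>UNIV. ?I (partial_deriv k (partial_deriv k u)))
      + 2 * \<i> * (\<Sum>k\<in>UNIV. of_real (?a $ k) * ?I (partial_deriv k u))
      + of_real ((norm ?a)\<^sup>2) * ?I u"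
    using i[OF s(1)] i[OF s(2)] i[OF u] by simp
  also have "\<dots> = of_real (magnetic_eigenvalue P p) * ?I u"
    unfolding integral_partial_deriv_torus_char[OF s(1) p] integral_partial_deriv_torus_char[OF u p]
    by (rule magnetic_symbol)
  finally show ?thesis .
qed

lemma magnetic_laplacian_smooth:
  assumes u: "u \<in> smooth_torus L"
  shows "magnetic_laplacian (\<lambda>x. a) u \<in> L2_space cell_measure"
  unfolding magnetic_laplacian_const[abs_def] sum_2
proof -
  have s: "partial_deriv k u \<in> L2_space cell_measure" "partial_deriv k (partial_deriv k u) \<in> L2_space cell_measure" for k
    using u by (auto intro!: smooth_partial_deriv smooth_L2)
  have "(\<lambda>x. (- 1) * (partial_deriv 1 (partial_deriv 1 u) x + partial_deriv 2 (partial_deriv 2 u) x) +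
      2 * \<i> * (of_real (a $ 1) * partial_deriv 1 u x + of_real (a $ 2) * partial_deriv 2 u x) +
      of_real ((norm a)\<^sup>2) * u x) \<in> L2_space cell_measure"
    by (intro L2_space_add L2_space_mult s smooth_L2 u)
  then show "(\<lambda>x. - (partial_deriv 1 (partial_deriv 1 u) x + partial_deriv 2 (partial_deriv 2 u) x) +
      2 * \<i> * (of_real (a $ 1) * partial_deriv 1 u x + of_real (a $ 2) * partial_deriv 2 u x) +
      of_real ((norm a)\<^sup>2) * u x) \<in> L2_space cell_measure"
    by simp
qed

lemma integral_torus_char:
  assumes "p \<in> dual_lattice L"
  shows "(LINT x|cell_measure. torus_char p x) = (if p = 0 then of_real (measure cell_measure UNIV) else 0)"
proof (cases "p = 0")
  case True
  then show ?thesis by (simp add: scaleR_conv_of_real)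
next
  case False
  have "torus_char 0 = (\<lambda>x. 1)" by (simp add: fun_eq_iff)
  then have one: "(\<lambda>x. 1) \<in> smooth_torus L" using torus_char_smooth[of 0] by (simp add: mem_dual_iff)
  \<comment> \<open>Integration by parts with the constant function 1, in the direction
    \<open>p\<close> itself, so that the factor contains p.p, which is nonzero.\<close>
  have "(2 * of_real pi * \<i> * of_real (p \<bullet> p)) * (LINT x|cell_measure. torus_char p x) = 0"
    using integral_derivative_torus_char[OF one assms, of p] by simp
  then show ?thesis using False by simp
qed

text \<open>Parseval for finite sums: in the expanded square only the diagonal terms survive, since
  \<open>p - q\<close> is a nonzero dual vector off the diagonal.\<close>

lemma L2_seminorm_trig_poly:
  assumes S: "S \<subseteq> dual_lattice L" "finite S"
  shows "(L2_seminorm cell_measure (trig_poly S c))\<^sup>2 = measure cell_measure UNIV * (\<Sum>p\<in>S. (cmod (c p))\<^sup>2)"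
proof -
  have d: "p - q \<in> dual_lattice L" if "p \<in> S" "q \<in> S" for p q
    using dual_lattice_add[OF _ dual_lattice_uminus, of p q] that S by auto
  have "of_real ((L2_seminorm cell_measure (trig_poly S c))\<^sup>2)
      = (LINT x|cell_measure. complex_of_real ((cmod (trig_poly S c x))\<^sup>2))"
    unfolding L2_seminorm_power2 by (rule integral_complex_of_real[symmetric])
  also have "\<dots> = (LINT x|cell_measure. (\<Sum>p\<in>S. \<Sum>q\<in>S. c p * cnj (c q) * torus_char (p - q) x))"
  proof (rule Bochner_Integration.integral_cong[OF refl])
    fix x
    have "complex_of_real ((cmod (trig_poly S c x))\<^sup>2) = trig_poly S c x * cnj (trig_poly S c x)"
      by (rule complex_norm_square)
    also have "\<dots> = (\<Sum>p\<in>S. \<Sum>q\<in>S. c p * cnj (c q) * torus_char (p + - q) x)"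
      unfolding torus_char_add
      by (simp add: trig_poly_def sum_product cnj_torus_char mult_ac)
    finally show "complex_of_real ((cmod (trig_poly S c x))\<^sup>2)
        = (\<Sum>p\<in>S. \<Sum>q\<in>S. c p * cnj (c q) * torus_char (p - q) x)" by simp
  qed
  also have "\<dots> = (\<Sum>p\<in>S. \<Sum>q\<in>S. c p * cnj (c q) * (LINT x|cell_measure. torus_char (p - q) x))"
    using cell.L2_imp_integrable[OF torus_char_L2[OF d]] by simp
  also have "\<dots> = (\<Sum>p\<in>S. \<Sum>q\<in>S. if p = q then c p * cnj (c q) * of_real (measure cell_measure UNIV) else 0)"
    using d by (intro sum.cong refl) (simp add: integral_torus_char)
  also have "\<dots> = of_real (measure cell_measure UNIV * (\<Sum>p\<in>S. (cmod (c p))\<^sup>2))"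
    using S(2) by (simp add: sum_distrib_left sum_distrib_right complex_norm_square mult_ac del: of_real_power)
  finally show ?thesis unfolding of_real_eq_iff .
qed

end

section \<open>Completeness of the characters\<close>

definition trig_polys :: "(real^2) set \<Rightarrow> (real^2 \<Rightarrow> complex) set" where
  "trig_polys L = {trig_poly S c | S c. finite S \<and> S \<subseteq> dual_lattice L}"

context flat_torus
begin

lemma trig_polys_cmult:
  assumes "f \<in> trig_polys L"
  shows "(\<lambda>x. a * f x) \<in> trig_polys L"
proof -
  obtain S c where "f = trig_poly S c" "finite S" "S \<subseteq> dual_lattice L"
    using assms by (auto simp: trig_polys_def)
  moreover from this have "(\<lambda>x. a * f x) = trig_poly S (\<lambda>p. a * c p)"
    by (simp add: fun_eq_iff flip: trig_poly_mult)
  ultimately show ?thesis unfolding trig_polys_def by blast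
qed

lemma trig_polys_char: "p \<in> dual_lattice L \<Longrightarrow> torus_char p \<in> trig_polys L"
  unfolding trig_polys_def torus_char_eq_trig_poly by blast

lemma zero_mem_dual: "0 \<in> dual_lattice L"
  by (simp add: mem_dual_iff)

lemma trig_polys_const: "(\<lambda>x. a) \<in> trig_polys L"
  using trig_polys_cmult[OF trig_polys_char[OF zero_mem_dual], of a] by simp

lemma trig_polys_add:
  assumes "f \<in> trig_polys L" "g \<in> trig_polys L"
  shows "(\<lambda>x. f x + g x) \<in> trig_polys L"
proof -
  obtain S c where S: "f = trig_poly S c" "finite S" "S \<subseteq> dual_lattice L"
    using assms by (auto simp: trig_polys_def)
  obtain T d where T: "g = trig_poly T d" "finite T" "T \<subseteq> dual_lattice L"
    using assms by (auto simp: trig_polys_def)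
  \<comment> \<open>Extension by zero puts both functions over the common frequency set
    \<open>S \<union> T\<close>.\<close>
  define c' where "c' p = (if p \<in> S then c p else 0)" for p
  define d' where "d' p = (if p \<in> T then d p else 0)" for p
  have "f x = trig_poly (S \<union> T) c' x" "g x = trig_poly (S \<union> T) d' x" for x
    using S T unfolding trig_poly_def
    by (auto intro!: sum.mono_neutral_cong_left simp: c'_def d'_def)
  then have "(\<lambda>x. f x + g x) = trig_poly (S \<union> T) (\<lambda>p. c' p + d' p)"
    by (simp add: trig_poly_def fun_eq_iff sum.distrib ring_distribs)
  then show ?thesis using S T unfolding trig_polys_def by blast
qed

lemma trig_polys_sum: "(\<And>i. i \<in> I \<Longrightarrow> f i \<in> trig_polys L) \<Longrightarrow> (\<lambda>x. \<Sum>i\<in>I. f i x) \<in> trig_polys L"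
  by (induction I rule: infinite_finite_induct) (auto intro: trig_polys_add trig_polys_const)

lemma trig_polys_mult:
  assumes "f \<in> trig_polys L" "g \<in> trig_polys L"
  shows "(\<lambda>x. f x * g x) \<in> trig_polys L"
proof -
  obtain S c where S: "f = trig_poly S c" "S \<subseteq> dual_lattice L"
    using assms by (auto simp: trig_polys_def)
  obtain T d where T: "g = trig_poly T d" "T \<subseteq> dual_lattice L"
    using assms by (auto simp: trig_polys_def)
  have "(\<lambda>x. \<Sum>p\<in>S. \<Sum>q\<in>T. c p * d q * torus_char (p + q) x) \<in> trig_polys L"
    using S T by (intro trig_polys_sum trig_polys_cmult trig_polys_char dual_lattice_add) auto
  also have "(\<lambda>x. \<Sum>p\<in>S. \<Sum>q\<in>T. c p * d q * torus_char (p + q) x) = (\<lambda>x. f x * g x)"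
    by (simp add: S T trig_poly_def sum_product torus_char_add mult_ac fun_eq_iff)
  finally show ?thesis .
qed

text \<open>Two points have the same image exactly when they differ by a lattice vector, because
  \<open>v'\<close> and \<open>w'\<close> give the lattice coordinates. The image lies in a product
  of two unit circles.\<close>

definition torus_embedding :: "real^2 \<Rightarrow> complex \<times> complex" where
  "torus_embedding x = (torus_char v' x, torus_char w' x)"

lemma trig_polys_Re_Im:
  assumes "p \<in> dual_lattice L"
  shows "(\<lambda>x. of_real (Re (torus_char p x))) \<in> trig_polys L" "(\<lambda>x. of_real (Im (torus_char p x))) \<in> trig_polys L"
proof -
  have "of_real (Re (torus_char p x)) = (1/2) * torus_char p x + (1/2) * torus_char (- p) x" for x
    by (simp add: complex_eq_iff flip: cnj_torus_char)
  then show "(\<lambda>x. of_real (Re (torus_char p x))) \<in> trig_polys L"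
    using assms by (simp only:) (intro trig_polys_add trig_polys_cmult trig_polys_char dual_lattice_uminus)
  have "of_real (Im (torus_char p x)) = (- \<i> / 2) * torus_char p x + (\<i> / 2) * torus_char (- p) x" for x
    by (simp add: complex_eq_iff flip: cnj_torus_char)
  then show "(\<lambda>x. of_real (Im (torus_char p x))) \<in> trig_polys L"
    using assms by (simp only:) (intro trig_polys_add trig_polys_cmult trig_polys_char dual_lattice_uminus)
qed

text \<open>A real linear functional of the two complex coordinates is a combination of their real
  and imaginary parts. These pull back to combinations of a character and its conjugate, and
  trigonometric polynomials form an algebra.\<close>

lemma real_polynomial_torus_embedding:
  assumes "real_polynomial_function r"
  shows "(\<lambda>x. of_real (r (torus_embedding x))) \<in> trig_polys L"
  using assms
proof (induction r rule: real_polynomial_function.induct)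
  case (linear f)
  interpret bounded_linear f by fact
  have "f z = f (1, 0) * Re (fst z) + f (\<i>, 0) * Im (fst z) + f (0, 1) * Re (snd z) + f (0, \<i>) * Im (snd z)" for z
  proof -
    have "z = Re (fst z) *\<^sub>R (1, 0) + Im (fst z) *\<^sub>R (\<i>, 0) + Re (snd z) *\<^sub>R (0, 1) + Im (snd z) *\<^sub>R (0, \<i>)"
      by (simp add: prod_eq_iff complex_eq_iff)
    then have "f z = f (Re (fst z) *\<^sub>R (1, 0) + Im (fst z) *\<^sub>R (\<i>, 0) + Re (snd z) *\<^sub>R (0, 1) + Im (snd z) *\<^sub>R (0, \<i>))"
      by (rule arg_cong)
    then show ?thesis unfolding add scaleR by (simp add: mult.commute)
  qed
  from this[of "torus_embedding _"] show ?case
    by (simp only: of_real_add of_real_mult torus_embedding_def fst_conv snd_conv)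
       (intro trig_polys_add trig_polys_cmult trig_polys_Re_Im dual_basis_mem)
qed (auto intro: trig_polys_const trig_polys_add trig_polys_mult)

lemma polynomial_torus_embedding:
  assumes "polynomial_function q"
  shows "(\<lambda>x. q (torus_embedding x)) \<in> trig_polys L"
proof -
  have "real_polynomial_function (\<lambda>z. Re (q z))" "real_polynomial_function (\<lambda>z. Im (q z))"
    using assms bounded_linear_Re bounded_linear_Im by (auto simp: polynomial_function_def o_def)
  then have "(\<lambda>x. of_real (Re (q (torus_embedding x))) + \<i> * of_real (Im (q (torus_embedding x)))) \<in> trig_polys L"
    by (intro trig_polys_add trig_polys_cmult real_polynomial_torus_embedding)
  then show ?thesis by (simp flip: complex_eq)
qed

text \<open>A Borel right inverse, modulo the lattice, of the embedding of the torus.\<close>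

definition torus_section :: "complex \<times> complex \<Rightarrow> real^2" where
  "torus_section z = (Im (Ln (fst z)) / (2 * pi)) *\<^sub>R v + (Im (Ln (snd z)) / (2 * pi)) *\<^sub>R w"

text \<open>The principal logarithm jumps along its branch cut but is Borel, which suffices to
  transport measurable functions.\<close>

lemma torus_section_measurable: "torus_section \<in> borel_measurable borel"
proof -
  have "fst \<in> borel_measurable (borel :: (complex \<times> complex) measure)"
    "snd \<in> borel_measurable (borel :: (complex \<times> complex) measure)"
    by (auto intro!: borel_measurable_continuous_onI continuous_intros)
  note [measurable] = measurable_compose[OF this(1) Ln_measurable] measurable_compose[OF this(2) Ln_measurable]
  have "(\<lambda>z. Im (Ln (fst z))) \<in> borel_measurable (borel :: (complex \<times> complex) measure)"
    "(\<lambda>z. Im (Ln (snd z))) \<in> borel_measurable (borel :: (complex \<times> complex) measure)"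
    by measurable
  then show ?thesis unfolding torus_section_def[abs_def] by measurable
qed

lemma Im_Ln_torus_char: "Im (Ln (torus_char p x)) / (2 * pi) - p \<bullet> x \<in> \<int>"
proof -
  have nz: "torus_char p x \<noteq> 0" by (simp add: torus_char_def)
  have "torus_char p x = exp (Ln (torus_char p x))" using nz by simp
  \<comment> \<open>A character has modulus 1, so the real part of its logarithm vanishes.\<close>
  also have "Ln (torus_char p x) = \<i> * of_real (Im (Ln (torus_char p x)))"
    by (simp add: complex_eq_iff Re_Ln[OF nz])
  finally have "exp (2 * of_real pi * \<i> * of_real (p \<bullet> x)) = exp (\<i> * of_real (Im (Ln (torus_char p x))))"
    by (simp add: torus_char_def)
  then obtain n :: int where "2 * of_real pi * \<i> * of_real (p \<bullet> x)
      = \<i> * of_real (Im (Ln (torus_char p x))) + of_real (of_int (2 * n) * pi) * \<i>"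
    unfolding exp_eq by blast
  then have "2 * pi * (p \<bullet> x) = Im (Ln (torus_char p x)) + 2 * n * pi"
    by (simp add: complex_eq_iff)
  then have "Im (Ln (torus_char p x)) / (2 * pi) - p \<bullet> x = of_int (- n)"
    by (simp add: field_simps)
  then show ?thesis by (metis Ints_of_int)
qed

lemma torus_section_embedding:
  assumes "lattice_invariant L g"
  shows "g (torus_section (torus_embedding x)) = g x"
proof -
  have "torus_section (torus_embedding x) - x \<in> L"
    unfolding mem_lattice_iff torus_section_def torus_embedding_def
    by (simp add: inner_diff_right inner_add_right dual_basis Im_Ln_torus_char)
  then have "g (x + (torus_section (torus_embedding x) - x)) = g x"
    using assms unfolding lattice_invariant_def by blast
  then show ?thesis by simp
qed

text \<open>An invariant \<open>g\<close> factors pointwise through the embedding, by means of the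
  section. Hence approximating \<open>g\<close> over the cell is the same as approximating
  \<open>G\<close> over the image measure, where polynomials are dense.\<close>

lemma trig_polys_dense:
  assumes g: "g \<in> L2_torus L" and e: "e > 0"
  obtains t where "t \<in> trig_polys L" "L2_seminorm cell_measure (\<lambda>x. g x - t x) < e"
proof -
  have gi: "lattice_invariant L g" and gL: "g \<in> L2_space cell_measure" using g by (auto simp: L2_torus_iff)
  have gm: "g \<in> borel_measurable borel" using L2_spaceD(1)[OF gL] by (simp add: borel_measurable_cell)
  have "continuous_on UNIV torus_embedding"
    unfolding torus_embedding_def[abs_def] torus_char_def by (intro continuous_intros)
  then have Em: "torus_embedding \<in> measurable cell_measure borel"
    by (simp add: borel_measurable_continuous_onI borel_measurable_cell)
  define \<mu> where "\<mu> = distr cell_measure borel torus_embedding"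
  have tr: "integrable \<mu> f \<longleftrightarrow> integrable cell_measure (\<lambda>x. f (torus_embedding x))"
      "integral\<^sup>L \<mu> f = (LINT x|cell_measure. f (torus_embedding x))"
    if "f \<in> borel_measurable borel" for f :: "_ \<Rightarrow> real"
    using that Em unfolding \<mu>_def by (auto simp: integrable_distr_eq integral_distr)
  define G where "G = (\<lambda>z. g (torus_section z))"
  have GE: "G (torus_embedding x) = g x" for x
    by (simp add: G_def torus_section_embedding[OF gi])
  have Gm: "G \<in> borel_measurable borel"
    unfolding G_def using measurable_compose[OF torus_section_measurable gm] .
  have m\<mu>: "borel_measurable \<mu> = borel_measurable borel"
    by (rule measurable_cong_sets) (auto simp: \<mu>_def)
  define K :: "(complex \<times> complex) set" where "K = sphere 0 1 \<times> sphere 0 1"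
  have "finite_measure \<mu>" unfolding \<mu>_def by (rule cell.finite_measure_distr[OF Em])
  moreover have "compact K" by (auto simp: K_def intro!: compact_Times)
  moreover from this have "AE z in \<mu>. z \<in> K"
    unfolding \<mu>_def using Em
    by (subst AE_distr_iff) (auto simp: K_def torus_embedding_def compact_imp_closed)
  moreover have "G \<in> L2_space \<mu>"
    using gL Gm by (auto simp: L2_space_def m\<mu> tr GE)
  ultimately obtain q where q: "polynomial_function q" "q \<in> L2_space \<mu>"
      "L2_seminorm \<mu> (\<lambda>z. G z - q z) < e"
    using polynomial_functions_dense_L2[of \<mu> K G e] e by (auto simp: \<mu>_def)
  have "q \<in> borel_measurable borel" using L2_spaceD(1)[OF q(2)] by (simp add: m\<mu>)
  then have "L2_seminorm \<mu> (\<lambda>z. G z - q z) = L2_seminorm cell_measure (\<lambda>x. g x - q (torus_embedding x))"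
    using Gm unfolding L2_seminorm_def by (subst tr) (auto simp: GE)
  then show ?thesis
    using that[OF polynomial_torus_embedding[OF q(1)]] q(3) by simp
qed

lemma trig_polys_L2: "t \<in> trig_polys L \<Longrightarrow> t \<in> L2_space cell_measure"
  by (auto simp: trig_polys_def intro: trig_poly_L2)

lemma complete_system_torus_char: "complete_system L (dual_lattice L) torus_char"
  unfolding complete_system_def
proof (intro conjI ballI allI impI)
  show "torus_char p \<in> L2_torus L" if "p \<in> dual_lattice L" for p
    using that by (simp add: L2_torus_iff torus_char_L2 torus_char_lattice_invariant)
  fix g and e :: real assume g: "g \<in> L2_torus L" and "e > 0"
  then obtain t where t: "t \<in> trig_polys L" "L2_seminorm cell_measure (\<lambda>x. g x - t x) < e"
    by (rule trig_polys_dense)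
  obtain S c where S: "t = trig_poly S c" "finite S" "S \<subseteq> dual_lattice L"
    using t(1) by (auto simp: trig_polys_def)
  have "(\<lambda>x. g x - t x) \<in> L2_space cell_measure"
    using g trig_polys_L2[OF t(1)] by (intro L2_space_diff) (auto simp: L2_torus_iff)
  then have "l2_norm L (\<lambda>x. g x - (\<Sum>p\<in>S. c p * torus_char p x)) < e"
    using t(2) S(1) by (simp add: l2_norm_L2 trig_poly_def)
  then show "\<exists>S c. finite S \<and> S \<subseteq> dual_lattice L \<and> l2_norm L (\<lambda>x. g x - (\<Sum>i\<in>S. c i * torus_char i x)) < e"
    using S by blast
qed

end

section \<open>The spectrum\<close>

context flat_torus
begin

text \<open>A dual vector is determined by its two integer pairings with the basis, and a bound on
  its norm bounds both by Cauchy-Schwarz.\<close>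

lemma finite_dual_lattice_bounded: "finite {p \<in> dual_lattice L. norm p \<le> R}"
proof -
  let ?D = "{p \<in> dual_lattice L. norm p \<le> R}"
  let ?Z = "\<lambda>e. {z \<in> \<int>. \<bar>z\<bar> \<le> R * norm e}"
  have "inj_on (\<lambda>p. (p \<bullet> v, p \<bullet> w)) ?D"
  proof (rule inj_onI)
    fix p q assume eq: "(p \<bullet> v, p \<bullet> w) = (q \<bullet> v, q \<bullet> w)"
    have "p \<bullet> x = q \<bullet> x" for x
      by (subst (1 2) basis_expansion[of x]) (use eq in \<open>simp add: inner_add_right\<close>)
    then have "(p - q) \<bullet> (p - q) = 0" by (simp add: inner_diff_left)
    then show "p = q" by simp
  qed
  moreover have "\<bar>p \<bullet> e\<bar> \<le> R * norm e" if "norm p \<le> R" for p e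
    using Cauchy_Schwarz_ineq2[of p e] mult_right_mono[OF that, of "norm e"] by simp
  then have "(\<lambda>p. (p \<bullet> v, p \<bullet> w)) ` ?D \<subseteq> ?Z v \<times> ?Z w"
    by (auto simp: mem_dual_iff)
  moreover have "finite (?Z v \<times> ?Z w)"
    by (intro finite_cartesian_product finite_abs_int_segment)
  ultimately show ?thesis using finite_subset inj_on_finite by blast
qed

lemma magnetic_spectral_gap:
  assumes "\<And>p. p \<in> dual_lattice L \<Longrightarrow> z \<noteq> of_real (magnetic_eigenvalue P p)"
  obtains d where "d > 0" "\<And>p. p \<in> dual_lattice L \<Longrightarrow> d \<le> cmod (of_real (magnetic_eigenvalue P p) - z)"
proof -
  let ?g = "\<lambda>p. cmod (of_real (magnetic_eigenvalue P p) - z)"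
  \<comment> \<open>Outside this finite set |P - p| exceeds |z| + 1, so the eigenvalue is at least
    |z| + 1 and its distance from \<open>z\<close> at least 1.\<close>
  define F where "F = {p \<in> dual_lattice L. norm p \<le> norm P + cmod z + 1}"
  have F: "finite F" unfolding F_def by (rule finite_dual_lattice_bounded)
  \<comment> \<open>The inserted 1 covers the frequencies outside \<open>F\<close> and keeps the
    minimum meaningful when \<open>F\<close> is empty.\<close>
  define d where "d = Min (insert 1 (?g ` F))"
  have "d > 0" unfolding d_def using F assms by (subst Min_gr_iff) (auto simp: F_def)
  moreover have "d \<le> ?g p" if p: "p \<in> dual_lattice L" for p
  proof (cases "p \<in> F")
    case True
    then show ?thesis unfolding d_def using F by (intro Min_le) auto
  next
    case False
    then have "norm p > norm P + cmod z + 1" using p by (auto simp: F_def)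
    then have n: "norm (P - p) > cmod z + 1" using norm_triangle_ineq3[of p P] by (simp add: norm_minus_commute)
    have "cmod z + 1 \<le> (cmod z + 1) * (cmod z + 1)" by (simp add: algebra_simps)
    also have "\<dots> \<le> norm (P - p) * norm (P - p)" using n by (intro mult_mono) auto
    also have "\<dots> \<le> (4 * pi\<^sup>2) * (norm (P - p) * norm (P - p))"
    proof -
      have "1 \<le> pi * pi" using mult_mono[of 1 pi 1 pi] pi_gt3 by simp
      then have "1 \<le> 4 * pi\<^sup>2" by (simp add: power2_eq_square)
      then show ?thesis using mult_right_mono[of 1 "4 * pi\<^sup>2" "norm (P - p) * norm (P - p)"] by simp
    qed
    finally have "cmod z + 1 \<le> magnetic_eigenvalue P p"
      by (simp add: magnetic_eigenvalue_def power2_eq_square)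
    then have "1 \<le> cmod (of_real (magnetic_eigenvalue P p)) - cmod z" by simp
    also have "\<dots> \<le> ?g p" by (rule norm_triangle_ineq2)
    finally have "1 \<le> ?g p" .
    moreover have "d \<le> 1" unfolding d_def using F by (intro Min_le) auto
    ultimately show ?thesis by simp
  qed
  ultimately show ?thesis by (rule that)
qed

lemma integral_mult_cnj_trig_poly:
  assumes u: "u \<in> L2_space cell_measure" and S: "S \<subseteq> dual_lattice L"
  shows "(LINT x|cell_measure. u x * cnj (trig_poly S c x))
    = (\<Sum>p\<in>S. cnj (c p) * (LINT x|cell_measure. u x * torus_char (- p) x))"
proof -
  have i: "integrable cell_measure (\<lambda>x. u x * torus_char (- p) x)" if "p \<in> S" for p
    using that S by (intro L2_space_mult_integrable u torus_char_L2 dual_lattice_uminus) auto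
  have "u x * cnj (trig_poly S c x) = (\<Sum>p\<in>S. cnj (c p) * (u x * torus_char (- p) x))" for x
    by (simp add: trig_poly_def cnj_torus_char sum_distrib_left mult_ac)
  then show ?thesis using i by simp
qed

text \<open>The smooth function is paired with a trigonometric polynomial, to which the resolvent is
  applied coefficientwise, and density turns the resulting bound into one of the norm.\<close>

lemma magnetic_apriori_estimate:
  assumes u: "u \<in> smooth_torus L" and d: "d > 0"
    and gap: "\<And>p. p \<in> dual_lattice L \<Longrightarrow> d \<le> cmod (of_real (magnetic_eigenvalue P p) - z)"
  shows "d * L2_seminorm cell_measure u
    \<le> L2_seminorm cell_measure (\<lambda>x. magnetic_laplacian (\<lambda>x. (2 * pi) *\<^sub>R P) u x - z * u x)"
proof -
  let ?N = "L2_seminorm cell_measure"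
  let ?D = "magnetic_laplacian (\<lambda>x. (2 * pi) *\<^sub>R P) u"
  define \<psi> where "\<psi> x = ?D x - z * u x" for x
  have uL: "u \<in> L2_space cell_measure" by (rule smooth_L2[OF u])
  have DL: "?D \<in> L2_space cell_measure" by (rule magnetic_laplacian_smooth[OF u])
  have \<psi>L: "\<psi> \<in> L2_space cell_measure"
    unfolding \<psi>_def[abs_def] by (intro L2_space_diff L2_space_mult uL DL)
  have coeff: "(LINT x|cell_measure. \<psi> x * torus_char (- p) x)
      = (of_real (magnetic_eigenvalue P p) - z) * (LINT x|cell_measure. u x * torus_char (- p) x)"
    if p: "p \<in> dual_lattice L" for p
  proof -
    note tL = torus_char_L2[OF dual_lattice_uminus[OF p]]
    have "(LINT x|cell_measure. \<psi> x * torus_char (- p) x)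
        = (LINT x|cell_measure. ?D x * torus_char (- p) x - z * (u x * torus_char (- p) x))"
      by (simp add: \<psi>_def algebra_simps)
    also have "\<dots> = (LINT x|cell_measure. ?D x * torus_char (- p) x) - z * (LINT x|cell_measure. u x * torus_char (- p) x)"
      using L2_space_mult_integrable[OF DL tL] L2_space_mult_integrable[OF uL tL] by simp
    finally show ?thesis
      by (simp add: integral_magnetic_laplacian_torus_char[OF u p] left_diff_distrib)
  qed
  have pair: "d * cmod (LINT x|cell_measure. u x * cnj (t x)) \<le> ?N \<psi> * ?N t" if tp: "t \<in> trig_polys L" for t
  proof -
    obtain S c where t: "t = trig_poly S c" and S: "finite S" "S \<subseteq> dual_lattice L"
      using tp by (auto simp: trig_polys_def)
    let ?g = "\<lambda>p. of_real (magnetic_eigenvalue P p) - z"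
    \<comment> \<open>The adjoint resolvent applied to \<open>t\<close>. The divisor is conjugated
      because the pairing is conjugate linear in its second argument; thus \<open>u\<close> against
      \<open>t\<close> equals \<psi> against \<open>t'\<close>.\<close>
    define t' where "t' = trig_poly S (\<lambda>p. c p / cnj (?g p))"
    have nz: "?g p \<noteq> 0" if "p \<in> S" for p
      using gap[of p] d that S by auto
    have "(LINT x|cell_measure. u x * cnj (t x)) = (LINT x|cell_measure. \<psi> x * cnj (t' x))"
      unfolding t t'_def integral_mult_cnj_trig_poly[OF uL S(2)] integral_mult_cnj_trig_poly[OF \<psi>L S(2)]
      using nz S by (intro sum.cong refl) (auto simp: coeff subset_iff simp del: right_minus_eq)
    also have "cmod \<dots> \<le> ?N \<psi> * ?N (\<lambda>x. cnj (t' x))"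
      by (intro L2_Cauchy_Schwarz \<psi>L L2_space_cnj) (simp add: t'_def trig_poly_L2 S)
    also have "?N (\<lambda>x. cnj (t' x)) = ?N t'" by (simp add: L2_seminorm_def)
    finally have 1: "cmod (LINT x|cell_measure. u x * cnj (t x)) \<le> ?N \<psi> * ?N t'" .
    \<comment> \<open>Parseval on both sides: dividing each coefficient by something of modulus at
      least \<open>d\<close> shrinks the norm by at least that factor.\<close>
    have "(d * ?N t')\<^sup>2 = measure cell_measure UNIV * (\<Sum>p\<in>S. (d * (cmod (c p) / cmod (?g p)))\<^sup>2)"
      unfolding t'_def power_mult_distrib L2_seminorm_trig_poly[OF S(2,1)]
      by (simp add: sum_distrib_left norm_divide power_mult_distrib mult_ac flip: complex_cnj_diff)
    also have "\<dots> \<le> measure cell_measure UNIV * (\<Sum>p\<in>S. (cmod (c p))\<^sup>2)"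
    proof (intro mult_left_mono sum_mono power_mono)
      fix p assume p: "p \<in> S"
      then have "d \<le> cmod (?g p)" "cmod (?g p) > 0" using gap[of p] nz[OF p] S by auto
      then have "d * cmod (c p) \<le> cmod (c p) * cmod (?g p)"
        using mult_right_mono[of d "cmod (?g p)" "cmod (c p)"] by (simp add: mult.commute)
      then show "d * (cmod (c p) / cmod (?g p)) \<le> cmod (c p)"
        using \<open>cmod (?g p) > 0\<close> by (simp add: pos_divide_le_eq)
    qed (use d in auto)
    also have "\<dots> = (?N t)\<^sup>2" unfolding t L2_seminorm_trig_poly[OF S(2,1)] ..
    finally have "d * ?N t' \<le> ?N t" by (rule power2_le_imp_le) simp
    then have "?N \<psi> * (d * ?N t') \<le> ?N \<psi> * ?N t" by (rule mult_left_mono) simp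
    moreover have "d * cmod (LINT x|cell_measure. u x * cnj (t x)) \<le> d * (?N \<psi> * ?N t')"
      using 1 d by (intro mult_left_mono) auto
    ultimately show ?thesis by (simp add: mult_ac)
  qed
  \<comment> \<open>The square of the norm is the pairing of \<open>u\<close> with itself; replacing
    one copy by a trigonometric polynomial within distance \<open>e\<close> costs the terms
    multiplied by \<open>e\<close>.\<close>
  have ineq: "d * (?N u)\<^sup>2 \<le> ?N \<psi> * ?N u + e * (?N \<psi> + d * ?N u)" if e: "e > 0" for e
  proof -
    have "u \<in> L2_torus L" by (simp add: L2_torus_iff uL smooth_invariant[OF u])
    then obtain t where t: "t \<in> trig_polys L" "?N (\<lambda>x. u x - t x) < e" using e by (rule trig_polys_dense)
    have tL: "t \<in> L2_space cell_measure" by (rule trig_polys_L2[OF t(1)])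
    have dL: "(\<lambda>x. u x - t x) \<in> L2_space cell_measure" by (rule L2_space_diff[OF uL tL])
    have "of_real ((?N u)\<^sup>2) = (LINT x|cell_measure. complex_of_real ((cmod (u x))\<^sup>2))"
      unfolding L2_seminorm_power2 by (rule integral_complex_of_real[symmetric])
    also have "\<dots> = (LINT x|cell_measure. u x * cnj (t x) + u x * cnj (u x - t x))"
      by (rule Bochner_Integration.integral_cong[OF refl]) (simp add: complex_norm_square ring_distribs del: of_real_power)
    also have "\<dots> = (LINT x|cell_measure. u x * cnj (t x)) + (LINT x|cell_measure. u x * cnj (u x - t x))"
      using L2_space_mult_integrable[OF uL L2_space_cnj[OF tL]] L2_space_mult_integrable[OF uL L2_space_cnj[OF dL]]
      by (rule Bochner_Integration.integral_add)
    finally have "(?N u)\<^sup>2 = cmod ((LINT x|cell_measure. u x * cnj (t x)) + (LINT x|cell_measure. u x * cnj (u x - t x)))"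
      by (metis abs_of_nonneg norm_of_real zero_le_power2)
    also have "\<dots> \<le> cmod (LINT x|cell_measure. u x * cnj (t x)) + cmod (LINT x|cell_measure. u x * cnj (u x - t x))"
      by (rule norm_triangle_ineq)
    also have "cmod (LINT x|cell_measure. u x * cnj (u x - t x)) \<le> ?N u * ?N (\<lambda>x. cnj (u x - t x))"
      by (rule L2_Cauchy_Schwarz[OF uL L2_space_cnj[OF dL]])
    also have "?N (\<lambda>x. cnj (u x - t x)) = ?N (\<lambda>x. u x - t x)" by (simp add: L2_seminorm_def flip: complex_cnj_diff)
    also have "?N u * ?N (\<lambda>x. u x - t x) \<le> ?N u * e" using t(2) by (intro mult_left_mono) auto
    finally have "(?N u)\<^sup>2 \<le> cmod (LINT x|cell_measure. u x * cnj (t x)) + ?N u * e" by simp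
    from mult_left_mono[OF this less_imp_le[OF d]]
    have "d * (?N u)\<^sup>2 \<le> d * cmod (LINT x|cell_measure. u x * cnj (t x)) + d * (?N u * e)"
      by (simp only: distrib_left)
    also have "\<dots> \<le> ?N \<psi> * ?N t + d * (?N u * e)" using pair[OF t(1)] by simp
    also have "?N t \<le> ?N u + e"
      using L2_seminorm_le_add_diff[OF tL uL] t(2) by (simp add: L2_seminorm_minus_commute[of _ t])
    then have "?N \<psi> * ?N t \<le> ?N \<psi> * (?N u + e)" by (rule mult_left_mono) simp
    finally show ?thesis by (simp add: algebra_simps)
  qed
  have "d * (?N u)\<^sup>2 \<le> ?N \<psi> * ?N u"
  proof (rule field_le_epsilon)
    fix e :: real assume e: "e > 0"
    \<comment> \<open>Rescaling by \<open>k\<close> makes the total error at most \<open>e\<close>;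
      the summand 1 makes \<open>k\<close> positive.\<close>
    define k where "k = ?N \<psi> + d * ?N u + 1"
    have k: "k > 0" using d by (simp add: k_def add_nonneg_pos)
    have "d * (?N u)\<^sup>2 \<le> ?N \<psi> * ?N u + (e / k) * (?N \<psi> + d * ?N u)"
      by (rule ineq) (use e k in simp)
    also have "(e / k) * (?N \<psi> + d * ?N u) \<le> (e / k) * k"
      using e k by (intro mult_left_mono) (auto simp: k_def)
    finally show "d * (?N u)\<^sup>2 \<le> ?N \<psi> * ?N u + e" using k by simp
  qed
  then have "d * ?N u \<le> ?N \<psi>"
    \<comment> \<open>The common factor \<open>?N u\<close> is cancelled; if it is zero, the claim
      is nonnegativity of a seminorm.\<close>
    by (cases "?N u = 0") (use L2_seminorm_nonneg[of cell_measure u] in \<open>auto simp: power2_eq_square less_le\<close>)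
  then show ?thesis unfolding \<psi>_def[abs_def] .
qed

text \<open>The a priori estimate holds along the smooth sequence that defines membership in the
  closure, and both of its sides converge.\<close>

lemma magnetic_closure_bound:
  assumes uh: "(u, h) \<in> magnetic_closure L (\<lambda>x. (2 * pi) *\<^sub>R P)" and d: "d > 0"
    and gap: "\<And>p. p \<in> dual_lattice L \<Longrightarrow> d \<le> cmod (of_real (magnetic_eigenvalue P p) - z)"
  shows "d * l2_norm L u \<le> l2_norm L (\<lambda>x. h x - z * u x)"
proof -
  let ?N = "L2_seminorm cell_measure"
  let ?D = "magnetic_laplacian (\<lambda>x. (2 * pi) *\<^sub>R P)"
  obtain \<phi> where uL: "u \<in> L2_space cell_measure" and hL: "h \<in> L2_space cell_measure"
    and \<phi>: "\<And>n. \<phi> n \<in> smooth_torus L"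
    and \<phi>u: "(\<lambda>n. l2_norm L (\<lambda>x. \<phi> n x - u x)) \<longlonglongrightarrow> 0"
    and \<phi>h: "(\<lambda>n. l2_norm L (\<lambda>x. ?D (\<phi> n) x - h x)) \<longlonglongrightarrow> 0"
    using uh by (auto simp: magnetic_closure_def L2_torus_iff)
  note \<phi>L = smooth_L2[OF \<phi>] and DL = magnetic_laplacian_smooth[OF \<phi>]
  have u_lim: "(\<lambda>n. ?N (\<lambda>x. \<phi> n x - u x)) \<longlonglongrightarrow> 0"
    using \<phi>u by (simp add: l2_norm_L2 L2_space_diff \<phi>L uL)
  have h_lim: "(\<lambda>n. ?N (\<lambda>x. ?D (\<phi> n) x - h x)) \<longlonglongrightarrow> 0"
    using \<phi>h by (simp add: l2_norm_L2 L2_space_diff DL hL)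
  have huL: "(\<lambda>x. h x - z * u x) \<in> L2_space cell_measure"
    by (intro L2_space_diff L2_space_mult uL hL)
  have \<psi>L: "(\<lambda>x. ?D (\<phi> n) x - z * \<phi> n x) \<in> L2_space cell_measure" for n
    by (intro L2_space_diff L2_space_mult \<phi>L DL)
  have "(\<lambda>n. ?N (\<lambda>x. (?D (\<phi> n) x - z * \<phi> n x) - (h x - z * u x))) \<longlonglongrightarrow> 0"
  proof (rule Lim_null_comparison[OF always_eventually])
    show "(\<lambda>n. ?N (\<lambda>x. ?D (\<phi> n) x - h x) + cmod z * ?N (\<lambda>x. \<phi> n x - u x)) \<longlonglongrightarrow> 0"
      using tendsto_add[OF h_lim tendsto_mult_right_zero[OF u_lim]] by simp
    have "?N (\<lambda>x. (?D (\<phi> n) x - h x) + (- z) * (\<phi> n x - u x))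
        \<le> ?N (\<lambda>x. ?D (\<phi> n) x - h x) + ?N (\<lambda>x. (- z) * (\<phi> n x - u x))" for n
      by (intro L2_seminorm_triangle L2_space_diff L2_space_mult \<phi>L DL uL hL)
    then have "?N (\<lambda>x. (?D (\<phi> n) x - h x) + (- z) * (\<phi> n x - u x))
        \<le> ?N (\<lambda>x. ?D (\<phi> n) x - h x) + cmod z * ?N (\<lambda>x. \<phi> n x - u x)" for n
      by (simp only: L2_seminorm_mult norm_minus_cancel)
    then show "\<forall>n. norm (?N (\<lambda>x. (?D (\<phi> n) x - z * \<phi> n x) - (h x - z * u x)))
        \<le> ?N (\<lambda>x. ?D (\<phi> n) x - h x) + cmod z * ?N (\<lambda>x. \<phi> n x - u x)"
      by (simp add: algebra_simps)
  qed
  then have "(\<lambda>n. ?N (\<lambda>x. ?D (\<phi> n) x - z * \<phi> n x)) \<longlonglongrightarrow> ?N (\<lambda>x. h x - z * u x)"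
    by (rule L2_seminorm_tendsto[OF \<psi>L huL])
  moreover have "(\<lambda>n. d * ?N (\<phi> n)) \<longlonglongrightarrow> d * ?N u"
    by (intro tendsto_mult_left L2_seminorm_tendsto[OF \<phi>L uL u_lim])
  ultimately have "d * ?N u \<le> ?N (\<lambda>x. h x - z * u x)"
    using magnetic_apriori_estimate[OF \<phi> d gap] by (intro LIMSEQ_le) auto
  then show ?thesis by (simp add: l2_norm_L2 uL huL)
qed

section \<open>Solving the resolvent equation\<close>

lemma magnetic_resolvent_trig_poly:
  fixes c :: "real^2 \<Rightarrow> complex"
  assumes S: "S \<subseteq> dual_lattice L" and d: "d > 0"
    and gap: "\<And>p. p \<in> dual_lattice L \<Longrightarrow> d \<le> cmod (of_real (magnetic_eigenvalue P p) - z)"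
  defines "s \<equiv> trig_poly S (\<lambda>p. c p / (of_real (magnetic_eigenvalue P p) - z))"
  shows "magnetic_laplacian (\<lambda>x. (2 * pi) *\<^sub>R P) s x - z * s x = trig_poly S c x"
proof -
  let ?g = "\<lambda>p. of_real (magnetic_eigenvalue P p) - z"
  have nz: "?g p \<noteq> 0" if "p \<in> S" for p using gap[of p] d S that by auto
  have "magnetic_laplacian (\<lambda>x. (2 * pi) *\<^sub>R P) s x - z * s x = (\<Sum>p\<in>S. ?g p * (c p / ?g p) * torus_char p x)"
    unfolding s_def magnetic_laplacian_trig_poly
    by (simp only: trig_poly_def sum_distrib_left sum_subtractf left_diff_distrib mult.assoc)
  also have "\<dots> = trig_poly S c x"
    unfolding trig_poly_def using nz by (intro sum.cong refl) (simp del: right_minus_eq)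
  finally show ?thesis .
qed

lemma trig_poly_extend:
  assumes "S \<subseteq> T" "finite T" "\<And>p. p \<in> T - S \<Longrightarrow> c p = 0"
  shows "trig_poly S c = trig_poly T c"
  unfolding trig_poly_def[abs_def] using assms by (intro ext sum.mono_neutral_left) auto

text \<open>For trigonometric polynomials the equation is solved coefficientwise. The a priori
  estimate turns convergence of the right-hand sides into the Cauchy property of the solutions, and
  the closure contains the limit.\<close>

lemma magnetic_resolvent_surj:
  assumes g: "g \<in> L2_torus L" and d: "d > 0"
    and gap: "\<And>p. p \<in> dual_lattice L \<Longrightarrow> d \<le> cmod (of_real (magnetic_eigenvalue P p) - z)"
  shows "\<exists>u h. (u, h) \<in> magnetic_closure L (\<lambda>x. (2 * pi) *\<^sub>R P) \<and> l2_norm L (\<lambda>x. h x - z * u x - g x) = 0"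
proof -
  let ?N = "L2_seminorm cell_measure"
  let ?D = "magnetic_laplacian (\<lambda>x. (2 * pi) *\<^sub>R P)"
  let ?g = "\<lambda>p. of_real (magnetic_eigenvalue P p) - z"
  have gi: "lattice_invariant L g" and gL: "g \<in> L2_space cell_measure" using g by (auto simp: L2_torus_iff)
  have "\<exists>t\<in>trig_polys L. ?N (\<lambda>x. g x - t x) < inverse (real (Suc n))" for n
    using trig_polys_dense[OF g, of "inverse (real (Suc n))"] by (metis inverse_positive_iff_positive of_nat_0_less_iff zero_less_Suc)
  then obtain t where t: "\<And>n. t n \<in> trig_polys L" "\<And>n. ?N (\<lambda>x. g x - t n x) < inverse (real (Suc n))"
    by metis
  \<comment> \<open>Coefficients are normalised to vanish outside \<open>S\<close>, so that two
    approximants can be written over the union of their frequency sets without changing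
    \<open>c\<close>.\<close>
  have "\<exists>S c. t n = trig_poly S c \<and> finite S \<and> S \<subseteq> dual_lattice L \<and> (\<forall>p. p \<notin> S \<longrightarrow> c p = 0)" for n
  proof -
    obtain S c where S: "t n = trig_poly S c" "finite S" "S \<subseteq> dual_lattice L"
      using t(1)[of n] by (auto simp: trig_polys_def)
    have "trig_poly S c = trig_poly S (\<lambda>p. if p \<in> S then c p else 0)"
      by (auto simp: trig_poly_def fun_eq_iff intro!: sum.cong)
    then show ?thesis using S by (intro exI[of _ S] exI[of _ "\<lambda>p. if p \<in> S then c p else 0"]) auto
  qed
  then obtain S c where tS: "\<And>n. t n = trig_poly (S n) (c n)" and fin: "\<And>n. finite (S n)"
    and S: "\<And>n. S n \<subseteq> dual_lattice L" and c: "\<And>n p. p \<notin> S n \<Longrightarrow> c n p = 0"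
    by metis
  define \<phi> where "\<phi> n = trig_poly (S n) (\<lambda>p. c n p / ?g p)" for n
  have \<phi>: "\<phi> n \<in> smooth_torus L" for n unfolding \<phi>_def by (rule trig_poly_smooth[OF S])
  note \<phi>L = smooth_L2[OF \<phi>] and tL = trig_polys_L2[OF t(1)]
  have eq: "?D (\<phi> n) x = t n x + z * \<phi> n x" for n x
    using magnetic_resolvent_trig_poly[OF S d gap, of n "c n" x] unfolding \<phi>_def tS by (simp add: algebra_simps)
  have t_lim: "(\<lambda>n. ?N (\<lambda>x. t n x - g x)) \<longlonglongrightarrow> 0"
  proof (rule Lim_null_comparison[OF always_eventually LIMSEQ_inverse_real_of_nat])
    show "\<forall>n. norm (?N (\<lambda>x. t n x - g x)) \<le> inverse (real (Suc n))"
      using t(2) by (auto simp: L2_seminorm_minus_commute[of _ _ g] less_imp_le)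
  qed
  have contr: "d * ?N (\<lambda>x. \<phi> i x - \<phi> j x) \<le> ?N (\<lambda>x. t i x - t j x)" for i j
  proof -
    define T where "T = S i \<union> S j"
    have T: "finite T" "T \<subseteq> dual_lattice L" "S i \<subseteq> T" "S j \<subseteq> T" using fin S by (auto simp: T_def)
    have ext: "\<phi> i = trig_poly T (\<lambda>p. c i p / ?g p)" "\<phi> j = trig_poly T (\<lambda>p. c j p / ?g p)"
      "t i = trig_poly T (c i)" "t j = trig_poly T (c j)"
      unfolding \<phi>_def tS using T c by (auto intro!: trig_poly_extend)
    define s where "s = trig_poly T (\<lambda>p. (c i p - c j p) / ?g p)"
    have s: "(\<lambda>x. \<phi> i x - \<phi> j x) = s"
      by (simp add: s_def ext trig_poly_def fun_eq_iff diff_divide_distrib left_diff_distrib sum_subtractf)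
    have "?D s x - z * s x = t i x - t j x" for x
    proof -
      have "?D s x - z * s x = trig_poly T (\<lambda>p. c i p - c j p) x"
        unfolding s_def by (rule magnetic_resolvent_trig_poly[OF T(2) d gap])
      then show ?thesis by (simp only: ext trig_poly_def left_diff_distrib sum_subtractf)
    qed
    then show ?thesis
      using magnetic_apriori_estimate[OF trig_poly_smooth[OF T(2)] d gap, of "\<lambda>p. (c i p - c j p) / ?g p"]
      by (simp add: s flip: s_def)
  qed
  have "\<exists>N. \<forall>i\<ge>N. \<forall>j\<ge>N. ?N (\<lambda>x. \<phi> i x - \<phi> j x) < e" if e: "e > 0" for e
  proof -
    obtain N where N: "\<And>n. n \<ge> N \<Longrightarrow> ?N (\<lambda>x. t n x - g x) < d * e / 2"
      using LIMSEQ_D[OF t_lim, of "d * e / 2"] d e by auto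
    have "?N (\<lambda>x. \<phi> i x - \<phi> j x) < e" if "i \<ge> N" "j \<ge> N" for i j
    proof -
      have "?N (\<lambda>x. t i x - t j x) \<le> ?N (\<lambda>x. t i x - g x) + ?N (\<lambda>x. g x - t j x)"
        by (rule L2_seminorm_triangle_diff[OF tL gL tL])
      also have "\<dots> < d * e"
        using N[OF that(1)] N[OF that(2)] by (simp add: L2_seminorm_minus_commute[of _ g])
      finally have "d * ?N (\<lambda>x. \<phi> i x - \<phi> j x) < d * e" using contr[of i j] by simp
      then show ?thesis using d by simp
    qed
    then show ?thesis by blast
  qed
  from cell.L2_complete[of \<phi>, OF \<phi>L this] obtain r :: "nat \<Rightarrow> nat" where
    uL: "(\<lambda>x. lim (\<lambda>n. \<phi> (r n) x)) \<in> L2_space cell_measure"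
    and u_lim: "(\<lambda>n. ?N (\<lambda>x. \<phi> n x - lim (\<lambda>n. \<phi> (r n) x))) \<longlonglongrightarrow> 0" by blast
  define u where "u x = lim (\<lambda>n. \<phi> (r n) x)" for x
  \<comment> \<open>With this choice the resolvent equation holds at every point; what remains is
    that the images of the \<phi>_n, namely t_n + z \<phi>_n, converge to \<open>h\<close>.\<close>
  define h where "h x = g x + z * u x" for x
  have uL: "u \<in> L2_space cell_measure" and u_lim: "(\<lambda>n. ?N (\<lambda>x. \<phi> n x - u x)) \<longlonglongrightarrow> 0"
    using uL u_lim by (simp_all add: u_def[abs_def])
  have hL: "h \<in> L2_space cell_measure" unfolding h_def[abs_def] by (intro L2_space_add L2_space_mult gL uL)
  \<comment> \<open>At x and at x + l the subsequence takes identical values, so \<open>lim\<close>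
    agrees there even if it does not converge.\<close>
  have ui: "lattice_invariant L u"
    using smooth_invariant[OF \<phi>] by (simp add: lattice_invariant_def u_def)
  then have hi: "lattice_invariant L h"
    using gi by (simp add: lattice_invariant_def h_def)
  have h_lim: "(\<lambda>n. ?N (\<lambda>x. ?D (\<phi> n) x - h x)) \<longlonglongrightarrow> 0"
  proof (rule Lim_null_comparison[OF always_eventually])
    show "(\<lambda>n. ?N (\<lambda>x. t n x - g x) + cmod z * ?N (\<lambda>x. \<phi> n x - u x)) \<longlonglongrightarrow> 0"
      using tendsto_add[OF t_lim tendsto_mult_right_zero[OF u_lim]] by simp
    have diff: "?D (\<phi> n) x - h x = (t n x - g x) + z * (\<phi> n x - u x)" for n x
      unfolding eq h_def by (simp add: algebra_simps)
    have "?N (\<lambda>x. (t n x - g x) + z * (\<phi> n x - u x)) \<le> ?N (\<lambda>x. t n x - g x) + ?N (\<lambda>x. z * (\<phi> n x - u x))" for n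
      by (intro L2_seminorm_triangle L2_space_diff L2_space_mult \<phi>L tL gL uL)
    then show "\<forall>n. norm (?N (\<lambda>x. ?D (\<phi> n) x - h x)) \<le> ?N (\<lambda>x. t n x - g x) + cmod z * ?N (\<lambda>x. \<phi> n x - u x)"
      by (simp add: L2_seminorm_mult diff)
  qed
  have "(u, h) \<in> magnetic_closure L (\<lambda>x. (2 * pi) *\<^sub>R P)"
    unfolding magnetic_closure_def using \<phi> u_lim h_lim
    by (auto simp: L2_torus_iff uL hL ui hi l2_norm_L2 L2_space_diff \<phi>L magnetic_laplacian_smooth intro!: exI[of _ \<phi>])
  moreover have "l2_norm L (\<lambda>x. h x - z * u x - g x) = 0"
    by (simp add: h_def l2_norm_def set_lebesgue_integral_def)
  ultimately show ?thesis by blast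
qed

text \<open>The constant sequence places a character and its multiple in the closure. A bounded
  inverse would then force the norm of the character to be at most C times 0, although the square of
  this norm is the positive measure of the cell.\<close>

lemma magnetic_eigenvalue_not_resolvent:
  assumes p: "p \<in> dual_lattice L"
  shows "of_real (magnetic_eigenvalue P p) \<notin> magnetic_resolvent_set L (\<lambda>x. (2 * pi) *\<^sub>R P)"
proof
  let ?z = "complex_of_real (magnetic_eigenvalue P p)"
  let ?D = "magnetic_laplacian (\<lambda>x. (2 * pi) *\<^sub>R P)"
  assume "?z \<in> magnetic_resolvent_set L (\<lambda>x. (2 * pi) *\<^sub>R P)"
  then have "\<exists>C. \<forall>(u, h)\<in>magnetic_closure L (\<lambda>x. (2 * pi) *\<^sub>R P).
      l2_norm L u \<le> C * l2_norm L (\<lambda>x. h x - ?z * u x)"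
    by (simp add: magnetic_resolvent_set_def)
  then obtain C where C: "\<forall>(u, h)\<in>magnetic_closure L (\<lambda>x. (2 * pi) *\<^sub>R P).
      l2_norm L u \<le> C * l2_norm L (\<lambda>x. h x - ?z * u x)" ..
  note s = torus_char_smooth[OF p]
  have e: "?D (torus_char p) x = ?z * torus_char p x" for x
    unfolding torus_char_eq_trig_poly magnetic_laplacian_trig_poly by (simp add: trig_poly_def)
  have 0: "l2_norm L (\<lambda>x. 0) = 0" by (simp add: l2_norm_def set_lebesgue_integral_def)
  have "(torus_char p, \<lambda>x. ?z * torus_char p x) \<in> magnetic_closure L (\<lambda>x. (2 * pi) *\<^sub>R P)"
    unfolding magnetic_closure_def using s smooth_invariant[OF s]
    by (auto simp: L2_torus_iff torus_char_L2[OF p] L2_space_mult lattice_invariant_def e 0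
        intro!: exI[of _ "\<lambda>_. torus_char p"])
  from bspec[OF C this] have "l2_norm L (torus_char p) \<le> 0" by (simp add: 0)
  then have "L2_seminorm cell_measure (torus_char p) = 0"
    using l2_norm_L2[OF torus_char_L2[OF p]] L2_seminorm_nonneg[of cell_measure "torus_char p"] by linarith
  moreover have "(L2_seminorm cell_measure (torus_char p))\<^sup>2 = measure cell_measure UNIV"
    unfolding L2_seminorm_power2 by simp
  ultimately show False using measure_cell_pos by simp
qed

lemma magnetic_spectrum_torus:
  "magnetic_spectrum L (\<lambda>x. (2 * pi) *\<^sub>R P) = {of_real (magnetic_eigenvalue P p) | p. p \<in> dual_lattice L}"
proof (intro equalityI subsetI)
  fix z assume z: "z \<in> magnetic_spectrum L (\<lambda>x. (2 * pi) *\<^sub>R P)"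
  show "z \<in> {of_real (magnetic_eigenvalue P p) | p. p \<in> dual_lattice L}"
  proof (rule ccontr)
    assume "z \<notin> {of_real (magnetic_eigenvalue P p) | p. p \<in> dual_lattice L}"
    then obtain d where d: "d > 0" and gap: "\<And>p. p \<in> dual_lattice L \<Longrightarrow> d \<le> cmod (of_real (magnetic_eigenvalue P p) - z)"
      using magnetic_spectral_gap[of z P] by blast
    \<comment> \<open>The inverse is bounded by the reciprocal of the spectral gap.\<close>
    have "l2_norm L u \<le> (1 / d) * l2_norm L (\<lambda>x. h x - z * u x)"
      if "(u, h) \<in> magnetic_closure L (\<lambda>x. (2 * pi) *\<^sub>R P)" for u h
      using magnetic_closure_bound[OF that d gap] d by (simp add: field_simps)
    then have "z \<in> magnetic_resolvent_set L (\<lambda>x. (2 * pi) *\<^sub>R P)"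
      unfolding magnetic_resolvent_set_def using magnetic_resolvent_surj[OF _ d gap] by blast
    then show False using z by (simp add: magnetic_spectrum_def)
  qed
next
  fix z :: complex assume "z \<in> {of_real (magnetic_eigenvalue P p) | p. p \<in> dual_lattice L}"
  then show "z \<in> magnetic_spectrum L (\<lambda>x. (2 * pi) *\<^sub>R P)"
    using magnetic_eigenvalue_not_resolvent by (auto simp: magnetic_spectrum_def)
qed

lemma magnetic_eigenfunction_torus_char:
  assumes p: "p \<in> dual_lattice L"
  shows "magnetic_eigenfunction L (\<lambda>x. (2 * pi) *\<^sub>R P) (of_real (magnetic_eigenvalue P p)) (torus_char p)"
proof -
  have "torus_char p \<noteq> (\<lambda>x. 0)" by (auto simp: torus_char_def fun_eq_iff)
  moreover have "magnetic_laplacian (\<lambda>x. (2 * pi) *\<^sub>R P) (torus_char p) x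
      = of_real (magnetic_eigenvalue P p) * torus_char p x" for x
    unfolding torus_char_eq_trig_poly magnetic_laplacian_trig_poly by (simp add: trig_poly_def)
  ultimately show ?thesis using torus_char_smooth[OF p] by (simp add: magnetic_eigenfunction_def)
qed

end

theorem theorem15:
  fixes L :: "(real^2) set" and \<alpha> \<beta> :: real
    and P :: "real^2" and A :: "real^2 \<Rightarrow> real^2"
    and f :: "real^2 \<Rightarrow> real^2 \<Rightarrow> complex" and ev :: "real^2 \<Rightarrow> real"
  assumes "full_rank_lattice L"
    and "P = vector [\<alpha>, \<beta>]"
    and "A = (\<lambda>x. (2 * pi) *\<^sub>R vector [\<alpha>, \<beta>])"
    and "f = (\<lambda>p x. exp (2 * of_real pi * \<i> * of_real (p \<bullet> x)))"
    and "ev = (\<lambda>p. 4 * pi\<^sup>2 * (norm (P - p))\<^sup>2)"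
  shows "(\<forall>p\<in>dual_lattice L. magnetic_eigenfunction L A (of_real (ev p)) (f p))
    \<and> complete_system L (dual_lattice L) f
    \<and> magnetic_spectrum L A = {of_real (ev p) | p. p \<in> dual_lattice L}"
proof -
  obtain v w where "flat_torus L v w" using full_rank_lattice_flat_torus[OF assms(1)] .
  then interpret flat_torus L v w .
  have "A = (\<lambda>x. (2 * pi) *\<^sub>R P)" "f = torus_char" "ev = magnetic_eigenvalue P"
    using assms by (simp_all add: torus_char_def[abs_def] magnetic_eigenvalue_def[abs_def])
  then show ?thesis
    using magnetic_eigenfunction_torus_char complete_system_torus_char magnetic_spectrum_torus by simp
qed

end
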